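(* Let $\mathbb{F}$ be an algebraically closed field with $\mathrm{Char}(\mathbb{F})\neq 2$ and let $d\ge 3$. Let $B,A^*$ be a bipartite Leonard pair over $\mathbb{F}$ with diameter $d$ that has reinforced dual $q$-Krawtchouk type. Let $(\{\theta'_i\}_{i=0}^d;\{\theta^*_i\}_{i=0}^d;\{\varphi'_i\}_{i=1}^d;\{\phi'_i\}_{i=1}^d)$ be a parameter array of $B,A^*$ with corresponding primary $q$-data $(\delta',\mu',h',\delta^*,\mu^*,h^*,\tau')$. For scalars $\delta,\mu,h,\tau$ in $\mathbb{F}$ the following are equivalent: (i) the sequence $(\delta,\mu,h,\delta^*,\mu^*,h^*,\tau)$ is a primary $q$-data of a near-bipartite expansion $A,A^*$ of $B,A^*$; (ii) the following conditions hold: $\mu\neq0$; $\mu\neq\pm\sqrt{-1}\,\mu' q^i$ for $1-d\le i\le d-1$; $\tau=0$; $h=\mu'h'/\mu$. Assume that (i) and (ii) hold. Then $A,A^*$ has reinforced dual $q$-Krawtchouk type.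
   Context: A tridiagonal matrix is irreducible if all its subdiagonal and superdiagonal entries are nonzero. Let $V$ be a vector space over $\mathbb{F}$ of dimension $d+1$. A Leonard pair on $V$ (with diameter $d$, over $\mathbb{F}$) is an ordered pair $A,A^*$ in $\mathrm{End}(V)$ such that (a) some basis of $V$ makes the matrix of $A$ irreducible tridiagonal and that of $A^*$ diagonal; (b) some basis of $V$ makes the matrix of $A^*$ irreducible tridiagonal and that of $A$ diagonal. ($A^*$ is just a name, not an adjoint.) Each of $A,A^*$ then has $d+1$ distinct eigenvalues. Flat part: let $E^*_0,\dots,E^*_d$ be the primitive idempotents of $A^*$ (projections onto its eigenspaces along the sum of the other eigenspaces). The flat part of $A$ is $F=\sum_{i=0}^d E^*_i A E^*_i$. $A,A^*$ is bipartite if $F=0$. $A,A^*$ is near-bipartite if $A-F,A^*$ is a Leonard pair on $V$; in that case $A-F,A^*$ is a bipartite Leonard pair called the bipartite contraction of $A,A^*$. A near-bipartite expansion of a bipartite Leonard pair $B,A^*$ on $V$ is a near-bipartite Leonard pair $A,A^*$ on $V$ whose bipartite contraction equals $B,A^*$. Parameter array: an ordering $\{\theta_i\}_{i=0}^d$ of the eigenvalues of $A$ is standard if in some basis $A$ is $\mathrm{diag}(\theta_0,\dots,\theta_d)$ and $A^*$ is irreducible tridiagonal; a standard ordering $\{\theta^*_i\}_{i=0}^d$ of the eigenvalues of $A^*$ is defined with the roles of $A$ and $A^*$ exchanged. Given standard orderings, there are unique scalars $\{\varphi_i\}_{i=1}^d$ such that in some basis $A$ is lower bidiagonal with diagonal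 $\theta_0,\dots,\theta_d$ and all subdiagonal entries $1$, while $A^*$ is upper bidiagonal with diagonal $\theta^*_0,\dots,\theta^*_d$ and superdiagonal $\varphi_1,\dots,\varphi_d$; and unique scalars $\{\phi_i\}_{i=1}^d$ such that in some basis $A$ is lower bidiagonal with diagonal $\theta_d,\theta_{d-1},\dots,\theta_0$ and all subdiagonal entries $1$, while $A^*$ is upper bidiagonal with diagonal $\theta^*_0,\dots,\theta^*_d$ and superdiagonal $\phi_1,\dots,\phi_d$. The sequence $(\{\theta_i\};\{\theta^*_i\};\{\varphi_i\};\{\phi_i\})$ is a parameter array of $A,A^*$. Type I: for $d\ge 3$ it is known that $\frac{\theta_{i-2}-\theta_{i+1}}{\theta_{i-1}-\theta_i}$ and $\frac{\theta^*_{i-2}-\theta^*_{i+1}}{\theta^*_{i-1}-\theta^*_i}$ are equal and independent of $i$ for $2\le i\le d-1$; their common value is written $\beta+1$, and $\beta$ is the fundamental constant. $A,A^*$ has type I if $\beta\neq\pm2$; then fix nonzero $q\in\mathbb{F}$ with $\beta=q^2+q^{-2}$ (so $q^4\ne1$). (Since $\beta$ is determined by $A^*$, a bipartite Leonard pair $B,A^*$ and its near-bipartite expansions share $\beta$, and the same $q$ is used for both.) It is known that a parameter array of type I has the form $\theta_i=\delta+\mu q^{2i-d}+hq^{d-2i}$, $\theta^*_i=\delta^*+\mu^*q^{2i-d}+h^*q^{d-2i}$ $(0\le i\le d)$, $\varphi_i=(q^i-q^{-i})(q^{d-i+1}-q^{i-d-1})(\tau-\mu\mu^*q^{2i-d-1}-hh^*q^{d-2i+1})$,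 $\phi_i=(q^i-q^{-i})(q^{d-i+1}-q^{i-d-1})(\tau-h\mu^*q^{2i-d-1}-\mu h^*q^{d-2i+1})$ $(1\le i\le d)$ for a unique sequence $(\delta,\mu,h,\delta^*,\mu^*,h^*,\tau)$ of scalars in $\mathbb{F}$, called the primary $q$-data corresponding to the parameter array. A primary $q$-data of $A,A^*$ is the primary $q$-data corresponding to some parameter array of $A,A^*$. $A,A^*$ has dual $q$-Krawtchouk type if it has type I, $(\theta^*_{i-1}-\theta^*_i)/(\theta^*_i-\theta^*_{i+1})$ is independent of $i$ for $1\le i\le d-1$, and $\varphi_i/\phi_i$ is independent of $i$ for $1\le i\le d$; it is reinforced if moreover $q^{2i}\neq-1$ for $1\le i\le d-1$. *)

theory Defs
  imports "HOL-Computational_Algebra.Computational_Algebra"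
begin

text \<open>
  The vector space \<open>V\<close> is the whole type \<open>'b\<close> of the library locale \<open>vector_space\<close>, with scalar
  multiplication \<open>scale\<close>. Square matrices with rows and columns indexed by \<open>0, \<dots>, d\<close> are functions
  \<open>nat \<Rightarrow> nat \<Rightarrow> 'a\<close>, and sequences of scalars are functions \<open>nat \<Rightarrow> 'a\<close>; values outside the relevant
  index range are never inspected.
\<close>

definition diagonal_matrix :: "nat \<Rightarrow> (nat \<Rightarrow> nat \<Rightarrow> 'a::zero) \<Rightarrow> bool" where
  "diagonal_matrix d M \<longleftrightarrow> (\<forall>i\<le>d. \<forall>j\<le>d. i \<noteq> j \<longrightarrow> M i j = 0)"

definition irreducible_tridiagonal :: "nat \<Rightarrow> (nat \<Rightarrow> nat \<Rightarrow> 'a::zero) \<Rightarrow> bool" where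
  "irreducible_tridiagonal d M \<longleftrightarrow>
     (\<forall>i\<le>d. \<forall>j\<le>d. (i + 1 < j \<or> j + 1 < i \<longrightarrow> M i j = 0) \<and>
                   (j = i + 1 \<or> i = j + 1 \<longrightarrow> M i j \<noteq> 0))"

definition diag :: "(nat \<Rightarrow> 'a::zero) \<Rightarrow> nat \<Rightarrow> nat \<Rightarrow> 'a" where
  "diag \<theta> = (\<lambda>i j. if i = j then \<theta> i else 0)"

definition lower_bidiagonal :: "(nat \<Rightarrow> 'a::zero_neq_one) \<Rightarrow> nat \<Rightarrow> nat \<Rightarrow> 'a" where
  "lower_bidiagonal \<theta> = (\<lambda>i j. if i = j then \<theta> i else if i = j + 1 then 1 else 0)"

text \<open>The superdiagonal entry in row \<open>i - 1\<close> and column \<open>i\<close> is \<open>\<phi> i\<close>, for \<open>1 \<le> i \<le> d\<close>.\<close>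

definition upper_bidiagonal :: "(nat \<Rightarrow> 'a::zero) \<Rightarrow> (nat \<Rightarrow> 'a) \<Rightarrow> nat \<Rightarrow> nat \<Rightarrow> 'a" where
  "upper_bidiagonal \<theta> \<phi> = (\<lambda>i j. if i = j then \<theta> i else if j = i + 1 then \<phi> j else 0)"

definition ordered_basis ::
    "('a::field \<Rightarrow> 'b::ab_group_add \<Rightarrow> 'b) \<Rightarrow>
     nat \<Rightarrow> (nat \<Rightarrow> 'b) \<Rightarrow> bool" where
  "ordered_basis scale d v \<longleftrightarrow>
     inj_on v {..d} \<and> \<not> module.dependent scale (v ` {..d}) \<and> module.span scale (v ` {..d}) = UNIV"

text \<open>Column convention: the image of the \<open>j\<close>-th basis vector is column \<open>j\<close> of the matrix.\<close>

definition represents ::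
    "('a::field \<Rightarrow> 'b::ab_group_add \<Rightarrow> 'b) \<Rightarrow>
     nat \<Rightarrow> (nat \<Rightarrow> 'b) \<Rightarrow> ('b \<Rightarrow> 'b) \<Rightarrow> (nat \<Rightarrow> nat \<Rightarrow> 'a) \<Rightarrow> bool" where
  "represents scale d v A M \<longleftrightarrow> (\<forall>j\<le>d. A (v j) = (\<Sum>i\<le>d. scale (M i j) (v i)))"

definition leonard_pair ::
    "('a::field \<Rightarrow> 'b::ab_group_add \<Rightarrow> 'b) \<Rightarrow>
     nat \<Rightarrow> ('b \<Rightarrow> 'b) \<Rightarrow> ('b \<Rightarrow> 'b) \<Rightarrow> bool" where
  "leonard_pair scale d A As \<longleftrightarrow>
     Vector_Spaces.linear scale scale A \<and> Vector_Spaces.linear scale scale As \<and>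
     (\<exists>v M D. ordered_basis scale d v \<and> represents scale d v A M \<and> irreducible_tridiagonal d M \<and>
              represents scale d v As D \<and> diagonal_matrix d D) \<and>
     (\<exists>v M D. ordered_basis scale d v \<and> represents scale d v As M \<and> irreducible_tridiagonal d M \<and>
              represents scale d v A D \<and> diagonal_matrix d D)"

definition eigenspace ::
    "('a::field \<Rightarrow> 'b::ab_group_add \<Rightarrow> 'b) \<Rightarrow>
     ('b \<Rightarrow> 'b) \<Rightarrow> 'a \<Rightarrow> 'b set" where
  "eigenspace scale T t = {w. T w = scale t w}"

definition eigenvalues ::
    "('a::field \<Rightarrow> 'b::ab_group_add \<Rightarrow> 'b) \<Rightarrow>
     ('b \<Rightarrow> 'b) \<Rightarrow> 'a set" where
  "eigenvalues scale T = {t. \<exists>w. w \<noteq> 0 \<and> w \<in> eigenspace scale T t}"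

text \<open>
  The projection onto the eigenspace for \<open>t\<close> along the sum of the other eigenspaces. It is
  well defined when \<open>T\<close> is diagonalizable, in particular for both members of a Leonard pair.
\<close>

definition primitive_idempotent ::
    "('a::field \<Rightarrow> 'b::ab_group_add \<Rightarrow> 'b) \<Rightarrow>
     ('b \<Rightarrow> 'b) \<Rightarrow> 'a \<Rightarrow> 'b \<Rightarrow> 'b" where
  "primitive_idempotent scale T t =
     (THE E. Vector_Spaces.linear scale scale E \<and>
             (\<forall>w\<in>eigenspace scale T t. E w = w) \<and>
             (\<forall>u\<in>eigenvalues scale T. u \<noteq> t \<longrightarrow> (\<forall>w\<in>eigenspace scale T u. E w = 0)))"

definition flat_part ::
    "('a::field \<Rightarrow> 'b::ab_group_add \<Rightarrow> 'b) \<Rightarrow>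
     ('b \<Rightarrow> 'b) \<Rightarrow> ('b \<Rightarrow> 'b) \<Rightarrow> 'b \<Rightarrow> 'b" where
  "flat_part scale A As =
     (\<lambda>w. \<Sum>t\<in>eigenvalues scale As.
            primitive_idempotent scale As t (A (primitive_idempotent scale As t w)))"

definition bipartite ::
    "('a::field \<Rightarrow> 'b::ab_group_add \<Rightarrow> 'b) \<Rightarrow>
     nat \<Rightarrow> ('b \<Rightarrow> 'b) \<Rightarrow> ('b \<Rightarrow> 'b) \<Rightarrow> bool" where
  "bipartite scale d A As \<longleftrightarrow> leonard_pair scale d A As \<and> flat_part scale A As = (\<lambda>w. 0)"

definition near_bipartite ::
    "('a::field \<Rightarrow> 'b::ab_group_add \<Rightarrow> 'b) \<Rightarrow>
     nat \<Rightarrow> ('b \<Rightarrow> 'b) \<Rightarrow> ('b \<Rightarrow> 'b) \<Rightarrow> bool" where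
  "near_bipartite scale d A As \<longleftrightarrow>
     leonard_pair scale d A As \<and> leonard_pair scale d (\<lambda>w. A w - flat_part scale A As w) As"

text \<open>\<open>A, As\<close> is a near-bipartite expansion of the bipartite Leonard pair \<open>B, As\<close>.\<close>

definition near_bipartite_expansion ::
    "('a::field \<Rightarrow> 'b::ab_group_add \<Rightarrow> 'b) \<Rightarrow>
     nat \<Rightarrow> ('b \<Rightarrow> 'b) \<Rightarrow> ('b \<Rightarrow> 'b) \<Rightarrow> ('b \<Rightarrow> 'b) \<Rightarrow> bool" where
  "near_bipartite_expansion scale d B A As \<longleftrightarrow>
     near_bipartite scale d A As \<and> (\<lambda>w. A w - flat_part scale A As w) = B"

text \<open>
  A standard ordering of the eigenvalues of the first map; the standard orderings for the second
  map of the pair are obtained by exchanging the arguments.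
\<close>

definition standard_ordering ::
    "('a::field \<Rightarrow> 'b::ab_group_add \<Rightarrow> 'b) \<Rightarrow>
     nat \<Rightarrow> ('b \<Rightarrow> 'b) \<Rightarrow> ('b \<Rightarrow> 'b) \<Rightarrow> (nat \<Rightarrow> 'a) \<Rightarrow> bool" where
  "standard_ordering scale d A As \<theta> \<longleftrightarrow>
     bij_betw \<theta> {..d} (eigenvalues scale A) \<and>
     (\<exists>v M. ordered_basis scale d v \<and> represents scale d v A (diag \<theta>) \<and>
            represents scale d v As M \<and> irreducible_tridiagonal d M)"

definition split_form ::
    "('a::field \<Rightarrow> 'b::ab_group_add \<Rightarrow> 'b) \<Rightarrow>
     nat \<Rightarrow> ('b \<Rightarrow> 'b) \<Rightarrow> ('b \<Rightarrow> 'b) \<Rightarrow> (nat \<Rightarrow> 'a) \<Rightarrow> (nat \<Rightarrow> 'a) \<Rightarrow> (nat \<Rightarrow> 'a) \<Rightarrow> bool" where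
  "split_form scale d A As \<theta> \<theta>s \<phi> \<longleftrightarrow>
     (\<exists>v. ordered_basis scale d v \<and> represents scale d v A (lower_bidiagonal \<theta>) \<and>
          represents scale d v As (upper_bidiagonal \<theta>s \<phi>))"

text \<open>
  \<open>vphi\<close> is the first split sequence and \<open>phi\<close> the second one, which belongs to the reversed
  ordering of the eigenvalues of \<open>A\<close>; both are indexed by \<open>1, \<dots>, d\<close>.
\<close>

definition parameter_array ::
    "('a::field \<Rightarrow> 'b::ab_group_add \<Rightarrow> 'b) \<Rightarrow>
     nat \<Rightarrow> ('b \<Rightarrow> 'b) \<Rightarrow> ('b \<Rightarrow> 'b) \<Rightarrow>
     (nat \<Rightarrow> 'a) \<Rightarrow> (nat \<Rightarrow> 'a) \<Rightarrow> (nat \<Rightarrow> 'a) \<Rightarrow> (nat \<Rightarrow> 'a) \<Rightarrow> bool" where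
  "parameter_array scale d A As \<theta> \<theta>s vphi phi \<longleftrightarrow>
     leonard_pair scale d A As \<and>
     standard_ordering scale d A As \<theta> \<and> standard_ordering scale d As A \<theta>s \<and>
     split_form scale d A As \<theta> \<theta>s vphi \<and> split_form scale d A As (\<lambda>i. \<theta> (d - i)) \<theta>s phi"

text \<open>
  Standard orderings are unique up to reversal, which does not change the quotients below, so
  \<open>\<beta>\<close> does not depend on the orderings chosen. For \<open>d < 3\<close> there is no fundamental constant.
\<close>

definition fundamental_constant ::
    "('a::field \<Rightarrow> 'b::ab_group_add \<Rightarrow> 'b) \<Rightarrow>
     nat \<Rightarrow> ('b \<Rightarrow> 'b) \<Rightarrow> ('b \<Rightarrow> 'b) \<Rightarrow> 'a \<Rightarrow> bool" where
  "fundamental_constant scale d A As \<beta> \<longleftrightarrow>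
     3 \<le> d \<and> leonard_pair scale d A As \<and>
     (\<exists>\<theta> \<theta>s. standard_ordering scale d A As \<theta> \<and> standard_ordering scale d As A \<theta>s \<and>
        (\<forall>i. 2 \<le> i \<and> i \<le> d - 1 \<longrightarrow>
           (\<theta> (i - 2) - \<theta> (i + 1)) / (\<theta> (i - 1) - \<theta> i) = \<beta> + 1 \<and>
           (\<theta>s (i - 2) - \<theta>s (i + 1)) / (\<theta>s (i - 1) - \<theta>s i) = \<beta> + 1))"

text \<open>Type I, together with the choice of the scalar \<open>q\<close>.\<close>

definition type_I ::
    "('a::field \<Rightarrow> 'b::ab_group_add \<Rightarrow> 'b) \<Rightarrow>
     nat \<Rightarrow> 'a \<Rightarrow> ('b \<Rightarrow> 'b) \<Rightarrow> ('b \<Rightarrow> 'b) \<Rightarrow> bool" where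
  "type_I scale d q A As \<longleftrightarrow>
     (\<exists>\<beta>. fundamental_constant scale d A As \<beta> \<and> \<beta> \<noteq> 2 \<and> \<beta> \<noteq> - 2 \<and>
          q \<noteq> 0 \<and> \<beta> = q powi 2 + q powi (- 2))"

definition corresponding_primary_q_data ::
    "nat \<Rightarrow> 'a::field \<Rightarrow> (nat \<Rightarrow> 'a) \<Rightarrow> (nat \<Rightarrow> 'a) \<Rightarrow> (nat \<Rightarrow> 'a) \<Rightarrow> (nat \<Rightarrow> 'a) \<Rightarrow>
     'a \<Rightarrow> 'a \<Rightarrow> 'a \<Rightarrow> 'a \<Rightarrow> 'a \<Rightarrow> 'a \<Rightarrow> 'a \<Rightarrow> bool" where
  "corresponding_primary_q_data d q \<theta> \<theta>s vphi phi \<delta> \<mu> h \<delta>s \<mu>s hs \<tau> \<longleftrightarrow>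
     (\<forall>i\<le>d.
        \<theta> i = \<delta> + \<mu> * q powi (2 * int i - int d) + h * q powi (int d - 2 * int i) \<and>
        \<theta>s i = \<delta>s + \<mu>s * q powi (2 * int i - int d) + hs * q powi (int d - 2 * int i)) \<and>
     (\<forall>i. 1 \<le> i \<and> i \<le> d \<longrightarrow>
        vphi i = (q powi int i - q powi (- int i)) *
                 (q powi (int d - int i + 1) - q powi (int i - int d - 1)) *
                 (\<tau> - \<mu> * \<mu>s * q powi (2 * int i - int d - 1)
                    - h * hs * q powi (int d - 2 * int i + 1)) \<and>
        phi i = (q powi int i - q powi (- int i)) *
                (q powi (int d - int i + 1) - q powi (int i - int d - 1)) *
                (\<tau> - h * \<mu>s * q powi (2 * int i - int d - 1)
                   - \<mu> * hs * q powi (int d - 2 * int i + 1)))"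

definition primary_q_data ::
    "('a::field \<Rightarrow> 'b::ab_group_add \<Rightarrow> 'b) \<Rightarrow>
     nat \<Rightarrow> 'a \<Rightarrow> ('b \<Rightarrow> 'b) \<Rightarrow> ('b \<Rightarrow> 'b) \<Rightarrow>
     'a \<Rightarrow> 'a \<Rightarrow> 'a \<Rightarrow> 'a \<Rightarrow> 'a \<Rightarrow> 'a \<Rightarrow> 'a \<Rightarrow> bool" where
  "primary_q_data scale d q A As \<delta> \<mu> h \<delta>s \<mu>s hs \<tau> \<longleftrightarrow>
     type_I scale d q A As \<and>
     (\<exists>\<theta> \<theta>s vphi phi. parameter_array scale d A As \<theta> \<theta>s vphi phi \<and>
        corresponding_primary_q_data d q \<theta> \<theta>s vphi phi \<delta> \<mu> h \<delta>s \<mu>s hs \<tau>)"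

text \<open>
  Reversing the eigenvalue orderings of \<open>A\<close> or \<open>As\<close> interchanges the two split sequences, up to
  reversal, so both conditions below hold for every parameter array as soon as they hold for one.
\<close>

definition dual_q_Krawtchouk ::
    "('a::field \<Rightarrow> 'b::ab_group_add \<Rightarrow> 'b) \<Rightarrow>
     nat \<Rightarrow> 'a \<Rightarrow> ('b \<Rightarrow> 'b) \<Rightarrow> ('b \<Rightarrow> 'b) \<Rightarrow> bool" where
  "dual_q_Krawtchouk scale d q A As \<longleftrightarrow>
     type_I scale d q A As \<and>
     (\<exists>\<theta> \<theta>s vphi phi. parameter_array scale d A As \<theta> \<theta>s vphi phi \<and>
        (\<exists>c. \<forall>i. 1 \<le> i \<and> i \<le> d - 1 \<longrightarrow>
           (\<theta>s (i - 1) - \<theta>s i) / (\<theta>s i - \<theta>s (i + 1)) = c) \<and>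
        (\<exists>c. \<forall>i. 1 \<le> i \<and> i \<le> d \<longrightarrow> vphi i / phi i = c))"

definition reinforced_dual_q_Krawtchouk ::
    "('a::field \<Rightarrow> 'b::ab_group_add \<Rightarrow> 'b) \<Rightarrow>
     nat \<Rightarrow> 'a \<Rightarrow> ('b \<Rightarrow> 'b) \<Rightarrow> ('b \<Rightarrow> 'b) \<Rightarrow> bool" where
  "reinforced_dual_q_Krawtchouk scale d q A As \<longleftrightarrow>
     dual_q_Krawtchouk scale d q A As \<and> (\<forall>i. 1 \<le> i \<and> i \<le> d - 1 \<longrightarrow> q ^ (2 * i) \<noteq> - 1)"

end

theory Submission
  imports Defs
begin

text \<open>
  The ratio condition on \<open>\<theta>s\<close> forces \<open>\<mu>s * hs = 0\<close>, and replacing \<open>q\<close> by its inverse while exchanging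
  \<open>\<mu>\<close> with \<open>h\<close> and \<open>\<mu>s\<close> with \<open>hs\<close> reduces to \<open>hs = 0\<close>. In an eigenbasis of \<open>As\<close>, an expansion of \<open>B\<close>
  differs from \<open>B\<close> only on the diagonal, so it has the same products of opposite off-diagonal
  entries. These entries can be read off from the first split form. Vanishing of the diagonal for \<open>B\<close>
  gives \<open>\<delta>' = \<tau>' = \<mu>' + h' = 0\<close>, and comparing the products at three indices gives \<open>\<tau> = 0\<close> and
  \<open>\<mu> * h = \<mu>' * h'\<close>; the condition on \<open>\<mu>\<close> says that the eigenvalues of the expansion are distinct.
  Conversely, \<open>A\<close> is \<open>B\<close> plus a suitable diagonal map. An explicit change of basis produces its first
  split form, and the second one by exchanging \<open>\<mu>\<close> and \<open>h\<close>. Two split forms with nonzero split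
  sequences already make \<open>As\<close> irreducible tridiagonal in an eigenbasis of \<open>A\<close>.
\<close>

section \<open>Coordinates, eigenbases and the flat part\<close>

text \<open>The reduction to \<open>hs = 0\<close> makes \<open>\<theta>s i - \<theta>s j\<close> a
  multiple of \<open>q ^ (2 * i) - q ^ (2 * j)\<close>. Quotients of split scalars by such
  differences then have a closed form, the diagonal entries of \<open>A\<close> become quadratic
  polynomials in \<open>1 / q ^ (2 * i)\<close>, and the products of opposite off-diagonal entries
  become a common factor times a quadratic that is symmetric in \<open>\<mu>\<close> and
  \<open>h\<close>. Such quadratics are compared at three distinct points, which
  \<open>3 \<le> d\<close> provides. For \<open>\<tau> = 0\<close> the products see
  \<open>\<mu>\<close> and \<open>h\<close> only through \<open>\<mu> * h\<close>, which is why a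
  whole family of expansions belongs to one \<open>B\<close>.

  Eigenvalues \<open>\<theta> i\<close> and \<open>\<theta> j\<close> with
  \<open>i \<noteq> j\<close> coincide exactly when \<open>\<mu> = h * q powi (2 * k)\<close> for
  \<open>k = d - i - j\<close>, and this \<open>k\<close> ranges from \<open>1 - d\<close> to
  \<open>d - 1\<close>. With \<open>\<mu> * h = - (\<mu>' * \<mu>')\<close> the equation says that
  the square of \<open>\<mu>\<close> is minus the square of \<open>\<mu>' * q powi k\<close>; hence
  the square roots of -1.\<close>

context vector_space
begin

lemma ordered_basis_coeff_zero:
  assumes b: "ordered_basis scale d v" and s: "(\<Sum>i\<le>d. c i *s v i) = 0" and "i \<le> d"
  shows "c i = 0"
proof -
  have inj: "inj_on v {..d}" and ind: "independent (v ` {..d})"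
    using b by (auto simp: ordered_basis_def)
  let ?g = "\<lambda>x. c (the_inv_into {..d} v x)"
  have "(\<Sum>x\<in>v ` {..d}. ?g x *s x) = (\<Sum>i\<le>d. c i *s v i)"
    by (subst sum.reindex[OF inj]) (auto simp: the_inv_into_f_f[OF inj] intro!: sum.cong)
  then have "?g (v i) = 0"
    using independentD[OF ind, of "v ` {..d}" ?g "v i"] s \<open>i \<le> d\<close> by auto
  then show ?thesis using \<open>i \<le> d\<close> by (simp add: the_inv_into_f_f[OF inj])
qed

lemma ordered_basis_coeff_unique:
  assumes b: "ordered_basis scale d v"
    and s: "(\<Sum>i\<le>d. a i *s v i) = (\<Sum>i\<le>d. c i *s v i)" and "i \<le> d"
  shows "a i = c i"
proof -
  have "(\<Sum>i\<le>d. (a i - c i) *s v i) = 0"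
    using s by (simp add: scale_left_diff_distrib sum_subtractf)
  from ordered_basis_coeff_zero[OF b this \<open>i \<le> d\<close>] show ?thesis by simp
qed

lemma ordered_basis_expansion:
  assumes b: "ordered_basis scale d v"
  obtains c where "x = (\<Sum>i\<le>d. c i *s v i)"
proof -
  have inj: "inj_on v {..d}" and sp: "span (v ` {..d}) = UNIV"
    using b by (auto simp: ordered_basis_def)
  have "x \<in> range (\<lambda>u. \<Sum>y\<in>v ` {..d}. u y *s y)"
    using span_finite[of "v ` {..d}"] sp by auto
  then obtain u where "x = (\<Sum>y\<in>v ` {..d}. u y *s y)" by auto
  also have "\<dots> = (\<Sum>i\<le>d. u (v i) *s v i)" by (subst sum.reindex[OF inj]) simp
  finally show ?thesis by (rule that)
qed

text \<open>Spanning comes from counting: a vector outside the span would extend these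
  \<open>d + 1\<close> independent vectors to an independent set larger than the image of
  \<open>v0\<close>, which spans.\<close>

lemma ordered_basisI:
  assumes b: "ordered_basis scale d v0"
    and z: "\<And>c i. (\<Sum>i\<le>d. c i *s v i) = 0 \<Longrightarrow> i \<le> d \<Longrightarrow> c i = 0"
  shows "ordered_basis scale d v"
proof -
  have inj: "inj_on v {..d}"
  proof (rule inj_onI, rule ccontr)
    fix i j assume ij: "i \<in> {..d}" "j \<in> {..d}" "v i = v j" "i \<noteq> j"
    let ?c = "\<lambda>k. if k = i then 1 else if k = j then - 1 else 0"
    have "(\<Sum>k\<le>d. ?c k *s v k)
        = (\<Sum>k\<le>d. (if k = i then v i else 0)) - (\<Sum>k\<le>d. (if k = j then v j else 0))"
      unfolding sum_subtractf[symmetric] using ij by (intro sum.cong) (auto simp: scale_minus_left)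
    also have "\<dots> = 0" using ij by simp
    finally have "(\<Sum>k\<le>d. ?c k *s v k) = 0" .
    from z[of ?c i, OF this] ij(1) show False by simp
  qed
  have ind: "independent (v ` {..d})"
  proof (rule independent_if_scalars_zero)
    fix f x assume s: "(\<Sum>x\<in>v ` {..d}. f x *s x) = 0" and x: "x \<in> v ` {..d}"
    then obtain i where i: "i \<le> d" "x = v i" by auto
    have "(\<Sum>i\<le>d. f (v i) *s v i) = 0" using s by (subst (asm) sum.reindex[OF inj]) simp
    from z[OF this i(1)] show "f x = 0" using i by simp
  qed simp
  have sp: "span (v ` {..d}) = UNIV"
  proof (rule ccontr)
    assume "span (v ` {..d}) \<noteq> UNIV"
    then obtain x where x: "x \<notin> span (v ` {..d})" by auto
    have "independent (insert x (v ` {..d}))" by (rule independent_insertI[OF x ind])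
    from independent_span_bound[OF _ this, of "v0 ` {..d}"]
    have "card (insert x (v ` {..d})) \<le> card (v0 ` {..d})"
      using b by (auto simp: ordered_basis_def)
    moreover have "x \<notin> v ` {..d}" using x span_superset[of "v ` {..d}"] by auto
    ultimately show False using card_image[OF inj] card_image_le[of "{..d}" v0] by simp
  qed
  show ?thesis using inj ind sp by (simp add: ordered_basis_def)
qed

lemma sum_scale_change_basis:
  assumes u: "\<And>j. j \<le> d \<Longrightarrow> u j = (\<Sum>i\<le>d. C i j *s v i)"
  shows "(\<Sum>j\<le>d. c j *s u j) = (\<Sum>i\<le>d. (\<Sum>j\<le>d. C i j * c j) *s v i)"
proof -
  have "(\<Sum>j\<le>d. c j *s u j) = (\<Sum>j\<le>d. \<Sum>i\<le>d. (C i j * c j) *s v i)"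
    by (intro sum.cong) (auto simp: u scale_sum_right mult.commute)
  also have "\<dots> = (\<Sum>i\<le>d. \<Sum>j\<le>d. (C i j * c j) *s v i)" by (rule sum.swap)
  finally show ?thesis by (simp add: scale_sum_left)
qed

lemma ordered_basis_upper_triangular:
  assumes b: "ordered_basis scale d v"
    and u: "\<And>j. j \<le> d \<Longrightarrow> u j = (\<Sum>i\<le>d. C i j *s v i)"
    and tri: "\<And>i j. i \<le> d \<Longrightarrow> j < i \<Longrightarrow> C i j = 0"
    and dg: "\<And>i. i \<le> d \<Longrightarrow> C i i \<noteq> 0"
  shows "ordered_basis scale d u"
proof (rule ordered_basisI[OF b], rule ccontr)
  fix c k assume s: "(\<Sum>j\<le>d. c j *s u j) = 0" and k: "k \<le> d" "c k \<noteq> 0"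
  \<comment> \<open>The last index with a nonzero coefficient. In row \<open>m\<close> of the
    coordinate relation the earlier terms vanish by triangularity and the later ones by maximality,
    leaving \<open>C m m * c m\<close>.\<close>
  define m where "m = Max {j. j \<le> d \<and> c j \<noteq> 0}"
  have "m \<in> {j. j \<le> d \<and> c j \<noteq> 0}" unfolding m_def using k by (intro Max_in) auto
  then have m: "m \<le> d" "c m \<noteq> 0" by auto
  have mx: "c j = 0" if "m < j" "j \<le> d" for j
  proof (rule ccontr)
    assume "c j \<noteq> 0"
    then have "j \<le> m" unfolding m_def using that by (intro Max_ge) auto
    then show False using that by simp
  qed
  have "(\<Sum>j\<le>d. C m j * c j) = 0"
    using ordered_basis_coeff_zero[OF b, of "\<lambda>i. \<Sum>j\<le>d. C i j * c j" m]
      s sum_scale_change_basis[OF u] m by simp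
  moreover have "(\<Sum>j\<le>d. C m j * c j) = (\<Sum>j\<in>{m}. C m j * c j)"
    using m tri mx by (intro sum.mono_neutral_right) (auto, metis linorder_neqE_nat)
  ultimately show False using m dg by simp
qed

lemma ordered_basis_reverse:
  "ordered_basis scale d (\<lambda>i. v (d - i)) \<longleftrightarrow> ordered_basis scale d v"
proof -
  have bij: "bij_betw (\<lambda>i. d - i) {..d} {..d}"
    by (rule bij_betwI[where g = "\<lambda>i. d - i"]) auto
  then have im0: "(\<lambda>i. d - i) ` {..d} = {..d}" by (simp add: bij_betw_def)
  then have im: "(\<lambda>i. v (d - i)) ` {..d} = v ` {..d}"
    using image_image[of v "\<lambda>i. d - i" "{..d}"] by simp
  have "inj_on (v \<circ> (\<lambda>i. d - i)) {..d} \<longleftrightarrow> inj_on v {..d}"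
    using comp_inj_on_iff[of "\<lambda>i. d - i" "{..d}" v] bij im0 by (simp add: bij_betw_def)
  then show ?thesis unfolding ordered_basis_def im by (simp add: o_def)
qed

lemma sum_reverse: "(\<Sum>i\<le>d. f (d - i)) = (\<Sum>i\<le>(d::nat). f i)"
  by (rule sum.reindex_bij_witness[where i = "\<lambda>i. d - i" and j = "\<lambda>i. d - i"]) auto

lemma ordered_basis_lower_triangular:
  assumes b: "ordered_basis scale d v"
    and u: "\<And>j. j \<le> d \<Longrightarrow> u j = (\<Sum>i\<le>d. C i j *s v i)"
    and tri: "\<And>i j. j \<le> d \<Longrightarrow> i < j \<Longrightarrow> C i j = 0"
    and dg: "\<And>i. i \<le> d \<Longrightarrow> C i i \<noteq> 0"
  shows "ordered_basis scale d u"
proof -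
  have "ordered_basis scale d (\<lambda>j. u (d - j))"
  proof (rule ordered_basis_upper_triangular)
    show "ordered_basis scale d (\<lambda>i. v (d - i))" using b by (simp add: ordered_basis_reverse)
    show "u (d - j) = (\<Sum>i\<le>d. C (d - i) (d - j) *s v (d - i))" if "j \<le> d" for j
      using u[of "d - j"] sum_reverse[of "\<lambda>i. C i (d - j) *s v i" d] by simp
  qed (use tri dg in auto)
  then show ?thesis by (simp add: ordered_basis_reverse)
qed

lemma linear_sum_scale:
  assumes "Vector_Spaces.linear scale scale A"
  shows "A (\<Sum>i\<in>I. c i *s v i) = (\<Sum>i\<in>I. c i *s A (v i))"
proof -
  interpret A: Vector_Spaces.linear scale scale A by fact
  show ?thesis by (simp add: A.sum A.scale)
qed

lemma linear_coords:
  assumes "Vector_Spaces.linear scale scale A" "represents scale d v A M"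
  shows "A (\<Sum>j\<le>d. c j *s v j) = (\<Sum>i\<le>d. (\<Sum>j\<le>d. M i j * c j) *s v i)"
  unfolding linear_sum_scale[OF assms(1)]
  by (rule sum_scale_change_basis[of d "\<lambda>j. A (v j)"])
    (use assms(2) in \<open>simp add: represents_def\<close>)

lemma ex_represents:
  assumes b: "ordered_basis scale d v"
  shows "\<exists>M. represents scale d v A M"
proof -
  have "\<exists>c. A (v j) = (\<Sum>i\<le>d. c i *s v i)" for j
    using ordered_basis_expansion[OF b, of "A (v j)"] by metis
  then obtain c where "\<And>j. A (v j) = (\<Sum>i\<le>d. c j i *s v i)" by metis
  then show ?thesis by (intro exI[of _ "\<lambda>i j. c j i"]) (simp add: represents_def)
qed

text \<open>The matrix identity \<open>M C = C N\<close>, free of the inverse of \<open>C\<close>.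
  It is used in both directions: to extract recurrences for the entries of \<open>C\<close> or
  \<open>N\<close>, and to verify a claimed matrix in a new basis.\<close>

lemma represents_change_basis_iff:
  assumes lin: "Vector_Spaces.linear scale scale A" and b: "ordered_basis scale d v"
    and M: "represents scale d v A M"
    and u: "\<And>j. j \<le> d \<Longrightarrow> u j = (\<Sum>i\<le>d. C i j *s v i)"
  shows "represents scale d u A N \<longleftrightarrow>
    (\<forall>i\<le>d. \<forall>j\<le>d. (\<Sum>k\<le>d. M i k * C k j) = (\<Sum>k\<le>d. C i k * N k j))"
proof -
  have L: "A (u j) = (\<Sum>i\<le>d. (\<Sum>k\<le>d. M i k * C k j) *s v i)" if "j \<le> d" for j
    unfolding u[OF that] by (rule linear_coords[OF lin M])
  have R: "(\<Sum>i\<le>d. N i j *s u i) = (\<Sum>i\<le>d. (\<Sum>k\<le>d. C i k * N k j) *s v i)" for j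
    by (rule sum_scale_change_basis[OF u])
  show ?thesis
  proof
    assume "represents scale d u A N"
    then have eq: "(\<Sum>i\<le>d. (\<Sum>k\<le>d. M i k * C k j) *s v i)
        = (\<Sum>i\<le>d. (\<Sum>k\<le>d. C i k * N k j) *s v i)" if "j \<le> d" for j
      using L[OF that] R[of j] that by (simp add: represents_def)
    then show "\<forall>i\<le>d. \<forall>j\<le>d. (\<Sum>k\<le>d. M i k * C k j) = (\<Sum>k\<le>d. C i k * N k j)"
      using ordered_basis_coeff_unique[OF b eq] by blast
  next
    assume "\<forall>i\<le>d. \<forall>j\<le>d. (\<Sum>k\<le>d. M i k * C k j) = (\<Sum>k\<le>d. C i k * N k j)"
    then show "represents scale d u A N" by (simp add: represents_def L R)
  qed
qed

lemma linear_eq_on_ordered_basis: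
  assumes "Vector_Spaces.linear scale scale A" "Vector_Spaces.linear scale scale A'"
    "ordered_basis scale d v" "\<And>j. j \<le> d \<Longrightarrow> A (v j) = A' (v j)"
  shows "A = A'"
proof
  fix x
  obtain c where "x = (\<Sum>i\<le>d. c i *s v i)" using ordered_basis_expansion[OF assms(3)] .
  then show "A x = A' x" using assms by (simp add: linear_sum_scale)
qed

lemma linear_extend_ordered_basis:
  assumes "ordered_basis scale d v"
  obtains A where "Vector_Spaces.linear scale scale A" "\<And>j. j \<le> d \<Longrightarrow> A (v j) = f j"
proof -
  interpret p: vector_space_pair scale scale by unfold_locales
  have inj: "inj_on v {..d}" and ind: "independent (v ` {..d})"
    using assms by (auto simp: ordered_basis_def)
  obtain g where g: "Vector_Spaces.linear scale scale g"
      "\<forall>x\<in>v ` {..d}. g x = f (the_inv_into {..d} v x)"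
    using p.linear_independent_extend[OF ind, of "\<lambda>x. f (the_inv_into {..d} v x)"] by blast
  show ?thesis by (rule that[OF g(1)]) (use g(2) in \<open>simp add: the_inv_into_f_f[OF inj]\<close>)
qed

section \<open>Eigenbases, primitive idempotents and the flat part\<close>

lemma represents_diag:
  "represents scale d v T (diag t) \<longleftrightarrow> (\<forall>j\<le>d. T (v j) = t j *s v j)"
proof -
  have "(\<Sum>i\<le>d. diag t i j *s v i) = t j *s v j" if "j \<le> d" for j
  proof -
    have "(\<Sum>i\<le>d. diag t i j *s v i) = (\<Sum>i\<le>d. if i = j then t j *s v j else 0)"
      by (intro sum.cong) (auto simp: diag_def)
    then show ?thesis using that by simp
  qed
  then show ?thesis by (auto simp: represents_def)
qed

lemma ordered_basis_nonzero: "ordered_basis scale d v \<Longrightarrow> i \<le> d \<Longrightarrow> v i \<noteq> 0"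
  using dependent_zero[of "v ` {..d}"] by (force simp: ordered_basis_def)

lemma eigenvector_multiple:
  assumes lin: "Vector_Spaces.linear scale scale T" and b: "ordered_basis scale d v"
    and T: "represents scale d v T (diag t)" and inj: "inj_on t {..d}"
    and w: "T w = t i *s w" and i: "i \<le> d"
  obtains c where "w = c *s v i"
proof -
  obtain c where c: "w = (\<Sum>k\<le>d. c k *s v k)" using ordered_basis_expansion[OF b] .
  have "(\<Sum>k\<le>d. (c k * t k) *s v k) = (\<Sum>k\<le>d. (t i * c k) *s v k)"
    using w T unfolding c linear_sum_scale[OF lin] represents_diag
    by (simp add: scale_sum_right)
  then have "c k * t k = t i * c k" if "k \<le> d" for k
    using ordered_basis_coeff_unique[OF b, of "\<lambda>k. c k * t k" "\<lambda>k. t i * c k" k] that by simp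
  then have "c k = 0" if "k \<le> d" "k \<noteq> i" for k
    using that inj i by (metis atMost_iff inj_onD mult.commute mult_cancel_left)
  then have "w = (\<Sum>k\<in>{i}. c k *s v k)"
    unfolding c using i by (intro sum.mono_neutral_right) auto
  then show ?thesis using that[of "c i"] by simp
qed

lemma eigenvalues_diag:
  assumes lin: "Vector_Spaces.linear scale scale T" and b: "ordered_basis scale d v"
    and T: "represents scale d v T (diag t)"
  shows "eigenvalues scale T = t ` {..d}"
proof
  show "t ` {..d} \<subseteq> eigenvalues scale T"
    using T ordered_basis_nonzero[OF b] by (force simp: represents_diag eigenvalues_def eigenspace_def)
next
  show "eigenvalues scale T \<subseteq> t ` {..d}"
  proof
    fix s assume "s \<in> eigenvalues scale T"
    then obtain w where w: "w \<noteq> 0" "T w = s *s w" by (auto simp: eigenvalues_def eigenspace_def)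
    obtain c where c: "w = (\<Sum>k\<le>d. c k *s v k)" using ordered_basis_expansion[OF b] .
    have "(\<Sum>k\<le>d. (c k * t k) *s v k) = (\<Sum>k\<le>d. (s * c k) *s v k)"
      using w T unfolding c linear_sum_scale[OF lin] represents_diag
      by (simp add: scale_sum_right)
    then have e: "c k * t k = s * c k" if "k \<le> d" for k
      using ordered_basis_coeff_unique[OF b, of "\<lambda>k. c k * t k" "\<lambda>k. s * c k" k] that by simp
    have "\<exists>k\<le>d. c k \<noteq> 0" using w(1) unfolding c by (auto intro: ccontr)
    then show "s \<in> t ` {..d}" using e by (metis atMost_iff imageI mult.commute mult_cancel_left)
  qed
qed

text \<open>Since \<open>t\<close> is injective, eigenvectors for the same eigenvalue are
  proportional. Two eigenbases thus differ by a permutation and nonzero scalars, which move the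
  entries of \<open>X\<close> but keep their zero pattern.\<close>

lemma represents_relabel:
  assumes lin: "Vector_Spaces.linear scale scale T" "Vector_Spaces.linear scale scale X"
    and v: "ordered_basis scale d v" "represents scale d v T (diag t)" "inj_on t {..d}"
    and w: "ordered_basis scale d w" "represents scale d w T (diag (t \<circ> \<sigma>))"
    and \<sigma>: "\<And>i. i \<le> d \<Longrightarrow> \<sigma> i \<le> d" "inj_on \<sigma> {..d}"
    and M: "represents scale d v X M" and N: "represents scale d w X N"
    and ij: "i \<le> d" "j \<le> d"
  shows "N i j = 0 \<longleftrightarrow> M (\<sigma> i) (\<sigma> j) = 0"
proof -
  have "\<exists>c. w k = c *s v (\<sigma> k)" if "k \<le> d" for k
    using eigenvector_multiple[OF lin(1) v, of "w k" "\<sigma> k"] w(2) \<sigma>(1)[OF that] that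
    by (auto simp: represents_diag)
  then obtain c where c: "\<And>k. k \<le> d \<Longrightarrow> w k = c k *s v (\<sigma> k)" by metis
  have c0: "c k \<noteq> 0" if "k \<le> d" for k
    using c[OF that] ordered_basis_nonzero[OF w(1) that] by auto
  let ?C = "\<lambda>k l. if k = \<sigma> l then c l else 0"
  have "w l = (\<Sum>k\<le>d. ?C k l *s v k)" if "l \<le> d" for l
  proof -
    have "(\<Sum>k\<le>d. ?C k l *s v k) = (\<Sum>k\<le>d. if k = \<sigma> l then c l *s v k else 0)"
      by (intro sum.cong) auto
    then show ?thesis using c[OF that] \<sigma>(1)[OF that] by simp
  qed
  from represents_change_basis_iff[OF lin(2) v(1) M this, THEN iffD1, OF _ N]
  have "(\<Sum>k\<le>d. M (\<sigma> i) k * ?C k j) = (\<Sum>k\<le>d. ?C (\<sigma> i) k * N k j)"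
    using ij \<sigma>(1) by blast
  moreover have "(\<Sum>k\<le>d. M (\<sigma> i) k * ?C k j) = (\<Sum>k\<le>d. if k = \<sigma> j then M (\<sigma> i) (\<sigma> j) * c j else 0)"
    by (intro sum.cong) auto
  moreover have "(\<Sum>k\<le>d. ?C (\<sigma> i) k * N k j) = (\<Sum>k\<le>d. if k = i then c i * N i j else 0)"
    using ij \<sigma>(2) by (intro sum.cong) (auto dest: inj_onD)
  ultimately have "M (\<sigma> i) (\<sigma> j) * c j = c i * N i j" using ij \<sigma>(1) by simp
  then show ?thesis using c0 ij by (metis mult_eq_0_iff)
qed

text \<open>The definite description has to be shown satisfiable and unique. Its conditions fix the
  value on every \<open>v j\<close>, which gives uniqueness; the linear extension of these values
  satisfies them because each eigenspace is the line spanned by one \<open>v j\<close>.\<close>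

lemma primitive_idempotent_diag:
  assumes lin: "Vector_Spaces.linear scale scale T" and b: "ordered_basis scale d v"
    and T: "represents scale d v T (diag t)" and inj: "inj_on t {..d}" and i: "i \<le> d"
  shows "Vector_Spaces.linear scale scale (primitive_idempotent scale T (t i))"
    and "j \<le> d \<Longrightarrow> primitive_idempotent scale T (t i) (v j) = (if j = i then v i else 0)"
proof -
  let ?P = "\<lambda>E. Vector_Spaces.linear scale scale E \<and>
             (\<forall>w\<in>eigenspace scale T (t i). E w = w) \<and>
             (\<forall>u\<in>eigenvalues scale T. u \<noteq> t i \<longrightarrow> (\<forall>w\<in>eigenspace scale T u. E w = 0))"
  have char: "E (v j) = (if j = i then v i else 0)" if "?P E" "j \<le> d" for E j
  proof (cases "j = i")
    case True
    then show ?thesis using that T by (auto simp: eigenspace_def represents_diag)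
  next
    case False
    then have "t j \<noteq> t i" using inj i that(2) by (auto dest: inj_onD)
    moreover have "t j \<in> eigenvalues scale T" using that(2) eigenvalues_diag[OF lin b T] by auto
    moreover have "v j \<in> eigenspace scale T (t j)"
      using that(2) T by (auto simp: eigenspace_def represents_diag)
    ultimately show ?thesis using that False by auto
  qed
  obtain E where E: "Vector_Spaces.linear scale scale E"
      "\<And>j. j \<le> d \<Longrightarrow> E (v j) = (if j = i then v i else 0)"
    using linear_extend_ordered_basis[OF b, of "\<lambda>j. if j = i then v i else 0"] by metis
  interpret E: Vector_Spaces.linear scale scale E by (rule E(1))
  have PE: "?P E"
  proof (intro conjI ballI impI)
    fix w assume "w \<in> eigenspace scale T (t i)"
    then obtain c where "w = c *s v i"
      using eigenvector_multiple[OF lin b T inj _ i, of w] by (auto simp: eigenspace_def)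
    then show "E w = w" using E(2) i by (simp add: E.scale)
  next
    fix u w assume u: "u \<in> eigenvalues scale T" "u \<noteq> t i" and w: "w \<in> eigenspace scale T u"
    then obtain j where j: "j \<le> d" "u = t j" using eigenvalues_diag[OF lin b T] by auto
    then obtain c where "w = c *s v j"
      using eigenvector_multiple[OF lin b T inj _ j(1), of w] w by (auto simp: eigenspace_def)
    then show "E w = 0" using E(2) j u by (auto simp: E.scale)
  qed (rule E(1))
  have "?P (primitive_idempotent scale T (t i))"
    unfolding primitive_idempotent_def
  proof (rule theI[of ?P, OF PE])
    fix E' assume "?P E'"
    then show "E' = E"
      by (intro linear_eq_on_ordered_basis[OF _ E(1) b]) (use char E(2) in auto)
  qed
  then show "Vector_Spaces.linear scale scale (primitive_idempotent scale T (t i))"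
    and "j \<le> d \<Longrightarrow> primitive_idempotent scale T (t i) (v j) = (if j = i then v i else 0)"
    using char[of "primitive_idempotent scale T (t i)" j] by simp_all
qed

text \<open>On \<open>v j\<close> only the summand of the \<open>j\<close>-th eigenvalue survives,
  and its outer projection keeps a single coefficient of \<open>A (v j)\<close>. So the flat part is
  the diagonal of the matrix of \<open>A\<close> in any eigenbasis of \<open>T\<close>.\<close>

lemma flat_part_diag:
  assumes lin: "Vector_Spaces.linear scale scale T" and b: "ordered_basis scale d v"
    and T: "represents scale d v T (diag t)" and inj: "inj_on t {..d}"
    and A: "Vector_Spaces.linear scale scale A" "represents scale d v A M"
  shows "Vector_Spaces.linear scale scale (flat_part scale A T)"
    and "j \<le> d \<Longrightarrow> flat_part scale A T (v j) = M j j *s v j"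
proof -
  note E = primitive_idempotent_diag[OF lin b T inj]
  interpret p: vector_space_pair scale scale by unfold_locales
  let ?E = "\<lambda>i. primitive_idempotent scale T (t i)"
  have fl: "flat_part scale A T = (\<lambda>w. \<Sum>i\<le>d. ?E i (A (?E i w)))"
    unfolding flat_part_def eigenvalues_diag[OF lin b T] by (subst sum.reindex[OF inj]) simp
  have "Vector_Spaces.linear scale scale (\<lambda>w. ?E i (A (?E i w)))" if "i \<le> d" for i
    using Vector_Spaces.linear_compose[OF Vector_Spaces.linear_compose[OF E(1)[OF that] A(1)] E(1)[OF that]]
    by (simp add: o_def)
  then show "Vector_Spaces.linear scale scale (flat_part scale A T)"
    unfolding fl by (intro p.linear_compose_sum) auto
  show "flat_part scale A T (v j) = M j j *s v j" if j: "j \<le> d"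
  proof -
    have *: "?E i (A (?E i (v j))) = (if i = j then M j j *s v j else 0)" if i: "i \<le> d" for i
    proof -
      interpret Ei: Vector_Spaces.linear scale scale "?E i" by (rule E(1)[OF i])
      interpret A: Vector_Spaces.linear scale scale A by (rule A(1))
      have "?E j (A (v j)) = (\<Sum>k\<le>d. M k j *s ?E j (v k))"
        using A(2) j linear_sum_scale[OF E(1)[OF j]] by (simp add: represents_def)
      also have "\<dots> = (\<Sum>k\<le>d. if k = j then M j j *s v j else 0)"
        using E(2)[OF j] by (intro sum.cong) auto
      finally show ?thesis using E(2)[OF i j] j by auto
    qed
    show ?thesis unfolding fl using * j by simp
  qed
qed

end

section \<open>Split forms and tridiagonal matrices\<close>

lemma sum_mult_diag:
  fixes f :: "nat \<Rightarrow> 'a::comm_ring_1"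
  assumes "j \<le> d"
  shows "(\<Sum>k\<le>d. f k * diag t k j) = f j * t j"
proof -
  have "(\<Sum>k\<le>d. f k * diag t k j) = (\<Sum>k\<le>d. if k = j then f j * t j else 0)"
    by (intro sum.cong) (auto simp: diag_def)
  then show ?thesis using assms by simp
qed

lemma sum_diag_mult:
  fixes f :: "nat \<Rightarrow> 'a::comm_ring_1"
  assumes "i \<le> d"
  shows "(\<Sum>k\<le>d. diag t i k * f k) = t i * f i"
proof -
  have "(\<Sum>k\<le>d. diag t i k * f k) = (\<Sum>k\<le>d. if k = i then t i * f i else 0)"
    by (intro sum.cong) (auto simp: diag_def)
  then show ?thesis using assms by simp
qed

lemma irreducible_tridiagonalD:
  assumes "irreducible_tridiagonal d M"
  shows "i < d \<Longrightarrow> M i (i + 1) \<noteq> 0" "i < d \<Longrightarrow> M (i + 1) i \<noteq> 0"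
    "i \<le> d \<Longrightarrow> j \<le> d \<Longrightarrow> i + 1 < j \<or> j + 1 < i \<Longrightarrow> M i j = 0"
  using assms unfolding irreducible_tridiagonal_def by (metis Suc_eq_plus1 Suc_leI less_imp_le_nat)+

lemma sum_mult_lower_bidiagonal:
  fixes f :: "nat \<Rightarrow> 'a::comm_ring_1"
  assumes "j \<le> d"
  shows "(\<Sum>k\<le>d. f k * lower_bidiagonal \<theta> k j) = \<theta> j * f j + (if j < d then f (j + 1) else 0)"
proof -
  have "(\<Sum>k\<le>d. f k * lower_bidiagonal \<theta> k j)
      = (\<Sum>k\<le>d. if k = j then \<theta> j * f j else 0) + (\<Sum>k\<le>d. if k = j + 1 then f (j + 1) else 0)"
    unfolding sum.distrib[symmetric] by (intro sum.cong) (auto simp: lower_bidiagonal_def)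
  then show ?thesis using assms by auto
qed

lemma sum_lower_bidiagonal_mult:
  fixes f :: "nat \<Rightarrow> 'a::comm_ring_1"
  assumes "i \<le> d"
  shows "(\<Sum>k\<le>d. lower_bidiagonal \<theta> i k * f k) = \<theta> i * f i + (if 0 < i then f (i - 1) else 0)"
proof -
  have "(\<Sum>k\<le>d. lower_bidiagonal \<theta> i k * f k)
      = (\<Sum>k\<le>d. if k = i then \<theta> i * f i else 0)
        + (\<Sum>k\<le>d. if k = i - 1 then (if 0 < i then f (i - 1) else 0) else 0)"
    unfolding sum.distrib[symmetric] by (intro sum.cong) (auto simp: lower_bidiagonal_def)
  then show ?thesis using assms by auto
qed

lemma sum_mult_upper_bidiagonal:
  fixes f :: "nat \<Rightarrow> 'a::comm_ring_1"
  assumes "j \<le> d"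
  shows "(\<Sum>k\<le>d. f k * upper_bidiagonal \<theta> \<phi> k j) = \<theta> j * f j + (if 0 < j then \<phi> j * f (j - 1) else 0)"
proof -
  have "(\<Sum>k\<le>d. f k * upper_bidiagonal \<theta> \<phi> k j)
      = (\<Sum>k\<le>d. if k = j then \<theta> j * f j else 0)
        + (\<Sum>k\<le>d. if k = j - 1 then (if 0 < j then \<phi> j * f (j - 1) else 0) else 0)"
    unfolding sum.distrib[symmetric] by (intro sum.cong) (auto simp: upper_bidiagonal_def)
  then show ?thesis using assms by auto
qed

lemma sum_upper_bidiagonal_mult:
  fixes f :: "nat \<Rightarrow> 'a::comm_ring_1"
  assumes "i \<le> d"
  shows "(\<Sum>k\<le>d. upper_bidiagonal \<theta> \<phi> i k * f k)
    = \<theta> i * f i + (if i < d then \<phi> (i + 1) * f (i + 1) else 0)"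
proof -
  have "(\<Sum>k\<le>d. upper_bidiagonal \<theta> \<phi> i k * f k)
      = (\<Sum>k\<le>d. if k = i then \<theta> i * f i else 0)
        + (\<Sum>k\<le>d. if k = i + 1 then \<phi> (i + 1) * f (i + 1) else 0)"
    unfolding sum.distrib[symmetric] by (intro sum.cong) (auto simp: upper_bidiagonal_def)
  then show ?thesis using assms by auto
qed

lemma sum_tridiagonal_mult:
  fixes f :: "nat \<Rightarrow> 'a::comm_ring_1"
  assumes M: "irreducible_tridiagonal d M" and i: "i \<le> d"
  shows "(\<Sum>k\<le>d. M i k * f k) = (if 0 < i then M i (i - 1) * f (i - 1) else 0) + M i i * f i
    + (if i < d then M i (i + 1) * f (i + 1) else 0)"
proof -
  note z = irreducible_tridiagonalD(3)[OF M i]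
  have "(\<Sum>k\<le>d. M i k * f k)
      = (\<Sum>k\<le>d. if k = i - 1 then (if 0 < i then M i (i - 1) * f (i - 1) else 0) else 0)
        + (\<Sum>k\<le>d. if k = i then M i i * f i else 0)
        + (\<Sum>k\<le>d. if k = i + 1 then M i (i + 1) * f (i + 1) else 0)"
    unfolding sum.distrib[symmetric]
  proof (intro sum.cong refl)
    fix k assume k: "k \<in> {..d}"
    consider "k = i" | "i = k + 1" | "k = i + 1" | "i + 1 < k \<or> k + 1 < i" by linarith
    then show "M i k * f k = (if k = i - 1 then if 0 < i then M i (i - 1) * f (i - 1) else 0 else 0) +
         (if k = i then M i i * f i else 0) + (if k = i + 1 then M i (i + 1) * f (i + 1) else 0)"
    proof cases
      case 4
      then have "M i k = 0" "k \<noteq> i - 1 \<or> i = 0" "k \<noteq> i" "k \<noteq> i + 1" using z k by auto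
      then show ?thesis by auto
    qed auto
  qed
  then show ?thesis using i by auto
qed

text \<open>Injectivity forbids turning back, so all steps have the same sign \<open>e\<close>; the
  bounds \<open>0\<close> and \<open>d\<close> then force the walk to start at an end of the
  path.\<close>

lemma path_automorphism:
  fixes \<sigma> :: "nat \<Rightarrow> nat"
  assumes d: "1 \<le> d" and le: "\<And>i. i \<le> d \<Longrightarrow> \<sigma> i \<le> d" and inj: "inj_on \<sigma> {..d}"
    and adj: "\<And>i. i < d \<Longrightarrow> \<sigma> (i + 1) = \<sigma> i + 1 \<or> \<sigma> i = \<sigma> (i + 1) + 1"
  shows "(\<forall>i\<le>d. \<sigma> i = i) \<or> (\<forall>i\<le>d. \<sigma> i = d - i)"
proof -
  define e where "e = int (\<sigma> 1) - int (\<sigma> 0)"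
  have e: "e = 1 \<or> e = - 1" using adj[of 0] d by (auto simp: e_def)
  have step: "int (\<sigma> (i + 1)) = int (\<sigma> i) + e" if "i < d" for i
    using that
  proof (induction i)
    case 0
    then show ?case by (simp add: e_def)
  next
    case (Suc i)
    have "\<sigma> (Suc i + 1) \<noteq> \<sigma> i" using Suc.prems inj by (auto dest: inj_onD)
    then show ?case using Suc adj[of "Suc i"] adj[of i] e by auto
  qed
  have lin: "int (\<sigma> i) = int (\<sigma> 0) + e * int i" if "i \<le> d" for i
    using that
  proof (induction i)
    case (Suc i)
    then show ?case using step[of i] by (simp add: algebra_simps)
  qed simp
  show ?thesis
  proof (cases "e = 1")
    case True
    then have "\<sigma> 0 = 0" using lin[of d] le[of d] by simp
    then show ?thesis using True lin by simp
  next
    case False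
    then have "e = - 1" "\<sigma> 0 = d" using e lin[of d] le[of 0] by auto
    then have "\<sigma> i = d - i" if "i \<le> d" for i using lin[OF that] that by simp
    then show ?thesis by blast
  qed
qed

section \<open>Uniqueness of standard orderings, and matrices read off from split forms\<close>

context vector_space
begin

text \<open>Both orderings list the same eigenvalues, so they differ by a permutation. It preserves
  adjacency, because neighbours are detected by nonzero off-diagonal entries of \<open>X\<close>,
  hence it is an automorphism of a path.\<close>

lemma standard_ordering_unique:
  assumes d: "1 \<le> d"
    and lin: "Vector_Spaces.linear scale scale T" "Vector_Spaces.linear scale scale X"
    and s: "standard_ordering scale d T X t" "standard_ordering scale d T X t'"
  shows "(\<forall>i\<le>d. t' i = t i) \<or> (\<forall>i\<le>d. t' i = t (d - i))"
proof -
  obtain v M where v: "ordered_basis scale d v" "represents scale d v T (diag t)"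
      "represents scale d v X M" "irreducible_tridiagonal d M"
    and bij: "bij_betw t {..d} (eigenvalues scale T)"
    using s(1) by (auto simp: standard_ordering_def)
  obtain w N where w: "ordered_basis scale d w" "represents scale d w T (diag t')"
      "represents scale d w X N" "irreducible_tridiagonal d N"
    and bij': "bij_betw t' {..d} (eigenvalues scale T)"
    using s(2) by (auto simp: standard_ordering_def)
  have inj: "inj_on t {..d}" using bij by (simp add: bij_betw_def)
  define \<sigma> where "\<sigma> i = the_inv_into {..d} t (t' i)" for i
  have t': "t' i \<in> t ` {..d}" if "i \<le> d" for i
    using bij bij' that by (auto simp: bij_betw_def)
  have \<sigma>: "t (\<sigma> i) = t' i" "\<sigma> i \<le> d" if "i \<le> d" for i
    using f_the_inv_into_f[OF inj t'[OF that]] the_inv_into_into[OF inj t'[OF that], of "{..d}"]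
    by (auto simp: \<sigma>_def)
  have inj\<sigma>: "inj_on \<sigma> {..d}"
    using \<sigma>(1) bij' by (metis atMost_iff bij_betw_def inj_on_def)
  have w2: "represents scale d w T (diag (t \<circ> \<sigma>))"
    using w(2) \<sigma>(1) by (simp add: represents_diag)
  have adj: "\<sigma> (i + 1) = \<sigma> i + 1 \<or> \<sigma> i = \<sigma> (i + 1) + 1" if "i < d" for i
  proof -
    have "N i (i + 1) \<noteq> 0" using irreducible_tridiagonalD(1)[OF w(4) that] .
    then have "M (\<sigma> i) (\<sigma> (i + 1)) \<noteq> 0"
      using represents_relabel[OF lin v(1,2) inj w(1) w2 \<sigma>(2) inj\<sigma> v(3) w(3), of i "i + 1"] that
      by simp
    then have "\<not> (\<sigma> i + 1 < \<sigma> (i + 1) \<or> \<sigma> (i + 1) + 1 < \<sigma> i)"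
      using irreducible_tridiagonalD(3)[OF v(4) \<sigma>(2)[of i] \<sigma>(2)[of "i + 1"]] that by auto
    moreover have "\<sigma> i \<noteq> \<sigma> (i + 1)" using inj\<sigma> that by (auto dest: inj_onD)
    ultimately show ?thesis by linarith
  qed
  from path_automorphism[OF d \<sigma>(2) inj\<sigma> adj] show ?thesis using \<sigma>(1) by metis
qed

text \<open>Let \<open>C\<close> be the transition matrix from the eigenbasis \<open>v\<close> to
  the split basis. For \<open>0 < j\<close>, \<open>As\<close> gives
  \<open>(\<theta>s i - \<theta>s j) * C i j = \<phi> j * C i (j - 1)\<close>, so \<open>C\<close>
  is upper triangular and its first two superdiagonals follow from its diagonal by the ratios
  \<open>r i = \<phi> i / (\<theta>s (i - 1) - \<theta>s i)\<close> and
  \<open>s i = \<phi> i / (\<theta>s (i - 2) - \<theta>s i)\<close>. Comparing \<open>A\<close> on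
  the diagonal and on the superdiagonal yields the two formulas. The zeros prescribed for
  \<open>r\<close> and \<open>s\<close> at the ends make them uniform in \<open>i\<close>.\<close>

lemma split_form_tridiagonal_entries:
  assumes lin: "Vector_Spaces.linear scale scale A" "Vector_Spaces.linear scale scale As"
    and v: "ordered_basis scale d v" "represents scale d v As (diag \<theta>s)" "inj_on \<theta>s {..d}"
      "represents scale d v A M" "irreducible_tridiagonal d M"
    and split: "split_form scale d A As \<theta> \<theta>s \<phi>"
    and r: "r 0 = 0" "r (d + 1) = 0"
      "\<And>i. i < d \<Longrightarrow> r (i + 1) * (\<theta>s i - \<theta>s (i + 1)) = \<phi> (i + 1)"
    and s: "s (d + 1) = 0"
      "\<And>i. i + 1 < d \<Longrightarrow> s (i + 2) * (\<theta>s i - \<theta>s (i + 2)) = \<phi> (i + 2)"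
  shows "i \<le> d \<Longrightarrow> M i i = \<theta> i + r (i + 1) - r i"
    and "i < d \<Longrightarrow> M i (i + 1) * M (i + 1) i
      = r (i + 1) * (\<theta> (i + 1) - M i i + s (i + 2)) - r i * s (i + 1)"
proof -
  obtain u where u: "ordered_basis scale d u" "represents scale d u A (lower_bidiagonal \<theta>)"
      "represents scale d u As (upper_bidiagonal \<theta>s \<phi>)"
    using split by (auto simp: split_form_def)
  have "\<exists>c. u j = (\<Sum>i\<le>d. c i *s v i)" for j
    using ordered_basis_expansion[OF v(1), of "u j"] by metis
  then obtain c where c: "\<And>j. u j = (\<Sum>i\<le>d. c j i *s v i)" by metis
  define C where "C i j = c j i" for i j
  have C: "u j = (\<Sum>i\<le>d. C i j *s v i)" if "j \<le> d" for j by (simp add: C_def c)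
  have E1: "\<theta>s i * C i j = \<theta>s j * C i j + (if 0 < j then \<phi> j * C i (j - 1) else 0)"
    if "i \<le> d" "j \<le> d" for i j
    using represents_change_basis_iff[OF lin(2) v(1,2) C, THEN iffD1, OF _ u(3)] that
    by (simp add: sum_diag_mult sum_mult_upper_bidiagonal)
  have E2: "(if 0 < i then M i (i - 1) * C (i - 1) j else 0) + M i i * C i j
      + (if i < d then M i (i + 1) * C (i + 1) j else 0)
      = \<theta> j * C i j + (if j < d then C i (j + 1) else 0)" if "i \<le> d" "j \<le> d" for i j
    using represents_change_basis_iff[OF lin(1) v(1,4) C, THEN iffD1, OF _ u(2)] that
    by (simp add: sum_tridiagonal_mult[OF v(5)] sum_mult_lower_bidiagonal)
  have ne: "\<theta>s i \<noteq> \<theta>s j" if "i \<le> d" "j \<le> d" "i \<noteq> j" for i j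
    using v(3) that by (auto dest: inj_onD)
  have low: "C i j = 0" if "i \<le> d" "j < i" for i j
    using that
  proof (induction j)
    case 0
    then show ?case using E1[of i 0] ne[of i 0] by simp
  next
    case (Suc j)
    then show ?case using E1[of i "Suc j"] ne[of i "Suc j"] by simp
  qed
  have sub: "C (i + 1) (i + 1) = M (i + 1) i * C i i" if "i < d" for i
    using E2[of "i + 1" i] low[of "i + 2" i] low[of "i + 1" i] that by (auto split: if_splits)
  \<comment> \<open>\<open>C 0 0\<close> is the only coordinate of the nonzero vector
    \<open>u 0\<close> that can be nonzero; \<open>sub\<close> then carries nonvanishing down the
    diagonal, as \<open>M\<close> has no zero on its subdiagonal.\<close>
  have dg: "C i i \<noteq> 0" if "i \<le> d" for i
    using that
  proof (induction i)
    case 0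
    have "C i 0 = 0" if "i \<le> d" "i \<noteq> 0" for i using low that by simp
    moreover have "u 0 \<noteq> 0" using ordered_basis_nonzero[OF u(1)] by simp
    ultimately show ?case
      using C[of 0] sum.neutral[of "{..d}" "\<lambda>i. C i 0 *s v i"] by (metis atMost_iff le0 scale_zero_left)
  next
    case (Suc i)
    moreover have "M (i + 1) i \<noteq> 0" using irreducible_tridiagonalD(2)[OF v(5)] Suc.prems by simp
    ultimately show ?case using sub[of i] by simp
  qed
  have C1: "C i (i + 1) = r (i + 1) * C i i" if "i < d" for i
  proof -
    have "C i (i + 1) * (\<theta>s i - \<theta>s (i + 1)) = r (i + 1) * C i i * (\<theta>s i - \<theta>s (i + 1))"
      using E1[of i "i + 1"] r(3)[OF that] that by (simp add: algebra_simps)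
    then show ?thesis using ne[of i "i + 1"] that by simp
  qed
  have C2: "C i (i + 2) = s (i + 2) * r (i + 1) * C i i" if "i + 1 < d" for i
  proof -
    have "C i (i + 2) * (\<theta>s i - \<theta>s (i + 2)) = \<phi> (i + 2) * C i (i + 1)"
      using E1[of i "i + 2"] that by (simp add: algebra_simps)
    also have "\<dots> = s (i + 2) * r (i + 1) * C i i * (\<theta>s i - \<theta>s (i + 2))"
      using s(2)[of i] C1[of i] that by (simp add: algebra_simps)
    finally show ?thesis using ne[of i "i + 2"] that by simp
  qed
  show Mii: "M i i = \<theta> i + r (i + 1) - r i" if "i \<le> d" for i
  proof -
    have "(if 0 < i then M i (i - 1) * C (i - 1) i else 0) = r i * C i i"
      using C1[of "i - 1"] sub[of "i - 1"] that r(1) by (cases i) auto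
    moreover have "(if i < d then C i (i + 1) else 0) = r (i + 1) * C i i"
      using C1[of i] that r(2) by (cases "i = d") auto
    moreover have "(if i < d then M i (i + 1) * C (i + 1) i else 0) = 0" by (simp add: low)
    ultimately have "r i * C i i + M i i * C i i = \<theta> i * C i i + r (i + 1) * C i i"
      using E2[of i i] that by simp
    then have "(M i i) * C i i = (\<theta> i + r (i + 1) - r i) * C i i" by (simp add: algebra_simps)
    then show ?thesis using dg[OF that] by simp
  qed
  show "M i (i + 1) * M (i + 1) i
      = r (i + 1) * (\<theta> (i + 1) - M i i + s (i + 2)) - r i * s (i + 1)" if "i < d"
  proof -
    have "(if 0 < i then M i (i - 1) * C (i - 1) (i + 1) else 0) = r i * s (i + 1) * C i i"
      using C2[of "i - 1"] sub[of "i - 1"] that r(1) by (cases i) auto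
    moreover have "(if i + 1 < d then C i (i + 1 + 1) else 0) = s (i + 2) * r (i + 1) * C i i"
    proof (cases "i + 1 = d")
      case True
      then have "s (i + 2) * r (i + 1) = 0" using s(1) by simp
      then show ?thesis using C2[of i] that by auto
    qed (use C2[of i] that in auto)
    ultimately have "r i * s (i + 1) * C i i + M i i * C i (i + 1) + M i (i + 1) * C (i + 1) (i + 1)
        = \<theta> (i + 1) * C i (i + 1) + s (i + 2) * r (i + 1) * C i i"
      using E2[of i "i + 1"] that by simp
    then have "(M i (i + 1) * M (i + 1) i) * C i i
        = (r (i + 1) * (\<theta> (i + 1) - M i i + s (i + 2)) - r i * s (i + 1)) * C i i"
      unfolding sub[OF that] C1[OF that] by (simp add: algebra_simps)
    then show ?thesis using dg[of i] that by simp
  qed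
qed

text \<open>The columns of \<open>S\<close> are the eigenvectors of the lower bidiagonal matrix,
  found by solving \<open>(\<theta> j - \<theta> i) * S i j = S (i - 1) j\<close> from
  \<open>S j j = 1\<close>. Conjugating the upper bidiagonal matrix by a lower unitriangular one can
  only fill in below: the superdiagonal stays and the entries beyond it remain zero.\<close>

lemma lower_bidiagonal_eigenbasis:
  assumes lin: "Vector_Spaces.linear scale scale A" "Vector_Spaces.linear scale scale As"
    and inj: "inj_on \<theta> {..d}" and split: "split_form scale d A As \<theta> \<theta>s \<phi>"
  obtains w N where "ordered_basis scale d w" "represents scale d w A (diag \<theta>)"
    "represents scale d w As N" "\<And>i j. j \<le> d \<Longrightarrow> i + 1 < j \<Longrightarrow> N i j = 0"
    "\<And>i. i < d \<Longrightarrow> N i (i + 1) = \<phi> (i + 1)"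
proof -
  obtain u where u: "ordered_basis scale d u" "represents scale d u A (lower_bidiagonal \<theta>)"
      "represents scale d u As (upper_bidiagonal \<theta>s \<phi>)"
    using split by (auto simp: split_form_def)
  define S where "S i j = (if i < j then 0 else \<Prod>k\<in>{j<..i}. 1 / (\<theta> j - \<theta> k))" for i j
  have S0: "S i j = 0" if "i < j" for i j using that by (simp add: S_def)
  have S1: "S i i = 1" for i by (simp add: S_def)
  have Sstep: "S (Suc i) j * (\<theta> j - \<theta> (Suc i)) = S i j" if "Suc i \<le> d" "j \<le> i" for i j
  proof -
    have "{j<..Suc i} = insert (Suc i) {j<..i}" using that by auto
    moreover have "\<theta> j \<noteq> \<theta> (Suc i)" using inj that by (auto dest: inj_onD)
    ultimately show ?thesis using that by (simp add: S_def)
  qed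
  define w where "w j = (\<Sum>i\<le>d. S i j *s u i)" for j
  have wb: "ordered_basis scale d w"
    by (rule ordered_basis_lower_triangular[OF u(1), where C = S]) (auto simp: w_def S0 S1)
  have wS: "w j = (\<Sum>i\<le>d. S i j *s u i)" for j by (simp add: w_def)
  have wA: "represents scale d w A (diag \<theta>)"
  proof (subst represents_change_basis_iff[OF lin(1) u(1,2) wS], intro allI impI)
    fix i j assume ij: "i \<le> d" "j \<le> d"
    have "\<theta> i * S i j + (if 0 < i then S (i - 1) j else 0) = S i j * \<theta> j"
    proof (cases "i \<le> j")
      case True
      then show ?thesis by (cases "i = j") (auto simp: S0)
    next
      case False
      then obtain k where k: "i = Suc k" "j \<le> k" by (cases i) auto
      show ?thesis using Sstep[of k j] k ij by (simp add: algebra_simps)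
    qed
    then show "(\<Sum>k\<le>d. lower_bidiagonal \<theta> i k * S k j) = (\<Sum>k\<le>d. S i k * diag \<theta> k j)"
      using ij by (simp add: sum_lower_bidiagonal_mult sum_mult_diag)
  qed
  obtain N where N: "represents scale d w As N" using ex_represents[OF wb] by blast
  have eq: "(\<Sum>k\<le>d. S i k * N k j)
      = \<theta>s i * S i j + (if i < d then \<phi> (i + 1) * S (i + 1) j else 0)" if "i \<le> d" "j \<le> d" for i j
    using represents_change_basis_iff[OF lin(2) u(1,3) wS, THEN iffD1, OF N] that
    by (simp add: sum_upper_bidiagonal_mult)
  \<comment> \<open>\<open>S i k\<close> vanishes for \<open>k > i\<close> and
    \<open>S i i = 1\<close>, so a column of \<open>N\<close> that vanishes above row
    \<open>i\<close> meets row \<open>i\<close> of \<open>S\<close> only in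
    \<open>N i j\<close>.\<close>
  have single: "(\<Sum>k\<le>d. S i k * N k j) = N i j" if "i \<le> d" "\<And>k. k < i \<Longrightarrow> N k j = 0" for i j
  proof -
    have "(\<Sum>k\<le>d. S i k * N k j) = (\<Sum>k\<in>{i}. S i k * N k j)"
    proof (rule sum.mono_neutral_right)
      show "\<forall>k\<in>{..d} - {i}. S i k * N k j = 0"
        using that(2) S0[of i] by (auto simp: nat_neq_iff)
    qed (use that in auto)
    then show ?thesis by (simp add: S1)
  qed
  have N0: "N i j = 0" if "j \<le> d" "i + 1 < j" for i j
    using that
  proof (induction i rule: less_induct)
    case (less i)
    then show ?case using single[of i j] eq[of i j] by (simp add: S0)
  qed
  have N1: "N i (i + 1) = \<phi> (i + 1)" if "i < d" for i
    using single[of i "i + 1"] eq[of i "i + 1"] N0[of "i + 1"] that by (simp add: S0 S1)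
  show ?thesis by (rule that[OF wb wA N N0 N1])
qed

text \<open>In an eigenbasis of \<open>A\<close>, the first split form bounds the upper bandwidth of \<open>As\<close>, and the second
  one, which belongs to the reversed eigenbasis, bounds the lower bandwidth.\<close>

lemma split_forms_eigenbasis:
  assumes lin: "Vector_Spaces.linear scale scale A" "Vector_Spaces.linear scale scale As"
    and inj: "inj_on \<theta> {..d}" and split: "split_form scale d A As \<theta> \<theta>s \<phi>"
      "split_form scale d A As (\<lambda>i. \<theta> (d - i)) \<theta>s \<psi>"
    and nz: "\<And>i. 1 \<le> i \<Longrightarrow> i \<le> d \<Longrightarrow> \<phi> i \<noteq> 0" "\<And>i. 1 \<le> i \<Longrightarrow> i \<le> d \<Longrightarrow> \<psi> i \<noteq> 0"
  obtains w N where "ordered_basis scale d w" "represents scale d w A (diag \<theta>)"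
    "represents scale d w As N" "irreducible_tridiagonal d N"
proof -
  obtain w N where w: "ordered_basis scale d w" "represents scale d w A (diag \<theta>)"
      "represents scale d w As N" "\<And>i j. j \<le> d \<Longrightarrow> i + 1 < j \<Longrightarrow> N i j = 0"
      "\<And>i. i < d \<Longrightarrow> N i (i + 1) = \<phi> (i + 1)"
    using lower_bidiagonal_eigenbasis[OF lin inj split(1)] by metis
  have inj': "inj_on (\<lambda>i. \<theta> (d - i)) {..d}"
    using inj unfolding inj_on_def by (metis atMost_iff diff_diff_cancel diff_le_self)
  obtain w' N' where w': "ordered_basis scale d w'" "represents scale d w' A (diag (\<lambda>i. \<theta> (d - i)))"
      "represents scale d w' As N'" "\<And>i j. j \<le> d \<Longrightarrow> i + 1 < j \<Longrightarrow> N' i j = 0"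
      "\<And>i. i < d \<Longrightarrow> N' i (i + 1) = \<psi> (i + 1)"
    using lower_bidiagonal_eigenbasis[OF lin inj' split(2)] by metis
  have inj\<sigma>: "inj_on (\<lambda>i. d - i) {..d}" by (auto simp: inj_on_def)
  have w2: "represents scale d w' A (diag (\<theta> \<circ> (\<lambda>i. d - i)))" using w'(2) by (simp add: o_def)
  have rel: "N' i j = 0 \<longleftrightarrow> N (d - i) (d - j) = 0" if "i \<le> d" "j \<le> d" for i j
    using represents_relabel[OF lin w(1,2) inj w'(1) w2 _ inj\<sigma> w(3) w'(3) that] by simp
  have low: "N i j = 0" if "i \<le> d" "j + 1 < i" for i j
    using rel[of "d - i" "d - j"] w'(4)[of "d - j" "d - i"] that by simp
  have sub: "N (j + 1) j \<noteq> 0" if "j < d" for j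
  proof -
    have "d - j = (d - (j + 1)) + 1" using that by simp
    then have "N' (d - (j + 1)) (d - j) \<noteq> 0"
      using w'(5)[of "d - (j + 1)"] nz(2)[of "d - j"] that by simp
    then show ?thesis using rel[of "d - (j + 1)" "d - j"] that by simp
  qed
  have "irreducible_tridiagonal d N"
    unfolding irreducible_tridiagonal_def using w(4,5) low sub nz(1) by auto
  then show ?thesis using that w by blast
qed

end

section \<open>Scalar identities in the case hs = 0\<close>

lemma quadratic_eq_zero:
  fixes a b c :: "'a::field"
  assumes "a + b * x + c * x\<^sup>2 = 0" "a + b * y + c * y\<^sup>2 = 0" "a + b * z + c * z\<^sup>2 = 0"
    and ne: "x \<noteq> y" "x \<noteq> z" "y \<noteq> z"
  shows "a = 0 \<and> b = 0 \<and> c = 0"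
proof -
  have "(x - y) * (b + c * (x + y)) = 0" "(x - z) * (b + c * (x + z)) = 0"
    using assms(1-3) by algebra+
  then have *: "b + c * (x + y) = 0" "b + c * (x + z) = 0" using ne by auto
  then have "c * (y - z) = 0" by algebra
  then have "c = 0" using ne by simp
  then show ?thesis using * assms(1) by simp
qed

text \<open>With \<open>D = q ^ d\<close> and \<open>X = q ^ i\<close>, these are \<open>\<theta> i\<close>, the two leading factors of \<open>vphi i\<close>, and
  \<open>\<mu>s * q powi (2 * i - d - 1)\<close>.\<close>

definition q_eig :: "'a::field \<Rightarrow> 'a \<Rightarrow> 'a \<Rightarrow> 'a \<Rightarrow> 'a \<Rightarrow> 'a" where
  "q_eig D \<delta> \<mu> h X = \<delta> + \<mu> * X\<^sup>2 / D + h * D / X\<^sup>2"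

definition q_fac :: "'a::field \<Rightarrow> 'a \<Rightarrow> 'a \<Rightarrow> 'a" where
  "q_fac q D X = (X - 1 / X) * (D * q / X - X / (D * q))"

definition q_arg :: "'a::field \<Rightarrow> 'a \<Rightarrow> 'a \<Rightarrow> 'a \<Rightarrow> 'a" where
  "q_arg q D \<mu>s X = \<mu>s * X\<^sup>2 / (D * q)"

text \<open>Turns integer exponents into quotients of natural powers, so that all later scalar
  claims are rational identities in \<open>q\<close>, \<open>D\<close> and \<open>X\<close>.\<close>

lemma power_int_q_forms:
  fixes q :: "'a::field"
  assumes "q \<noteq> 0"
  shows "q powi (2 * int i - int d) = (q ^ i)\<^sup>2 / q ^ d"
    and "q powi (int d - 2 * int i) = q ^ d / (q ^ i)\<^sup>2"
    and "q powi (- int i) = 1 / q ^ i"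
    and "q powi (int d - int i + 1) = q ^ d * q / q ^ i"
    and "q powi (int i - int d - 1) = q ^ i / (q ^ d * q)"
    and "q powi (2 * int i - int d - 1) = (q ^ i)\<^sup>2 / (q ^ d * q)"
    and "q powi (int d - 2 * int i + 1) = q ^ d * q / (q ^ i)\<^sup>2"
proof -
  have [simp]: "q powi (2 * int i) = (q ^ i)\<^sup>2"
    using power_int_of_nat[of q "2 * i"] by (simp add: power_mult power_mult_distrib flip: power_even_eq)
  show "q powi (2 * int i - int d) = (q ^ i)\<^sup>2 / q ^ d"
    "q powi (int d - 2 * int i) = q ^ d / (q ^ i)\<^sup>2"
    "q powi (- int i) = 1 / q ^ i"
    "q powi (int d - int i + 1) = q ^ d * q / q ^ i"
    "q powi (int i - int d - 1) = q ^ i / (q ^ d * q)"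
    "q powi (2 * int i - int d - 1) = (q ^ i)\<^sup>2 / (q ^ d * q)"
    "q powi (int d - 2 * int i + 1) = q ^ d * q / (q ^ i)\<^sup>2"
    using assms by (simp_all add: power_int_diff power_int_add power_int_minus_divide)
qed

lemma q_data_hs_zero:
  fixes q :: "'a::field"
  assumes "q \<noteq> 0"
  shows "corresponding_primary_q_data d q \<theta> \<theta>s vphi phi \<delta> \<mu> h \<delta>s \<mu>s 0 \<tau> \<longleftrightarrow>
    (\<forall>i\<le>d. \<theta> i = q_eig (q ^ d) \<delta> \<mu> h (q ^ i) \<and> \<theta>s i = q_eig (q ^ d) \<delta>s \<mu>s 0 (q ^ i)) \<and>
    (\<forall>i. 1 \<le> i \<and> i \<le> d \<longrightarrow>
      vphi i = q_fac q (q ^ d) (q ^ i) * (\<tau> - \<mu> * q_arg q (q ^ d) \<mu>s (q ^ i)) \<and>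
      phi i = q_fac q (q ^ d) (q ^ i) * (\<tau> - h * q_arg q (q ^ d) \<mu>s (q ^ i)))"
  unfolding corresponding_primary_q_data_def power_int_q_forms[OF assms] q_eig_def q_fac_def q_arg_def
  by (simp add: power_int_of_nat mult.assoc)

text \<open>The eigenvalues combine a constant with geometric sequences of ratio
  \<open>x = q\<^sup>2\<close> and \<open>x = 1 / q\<^sup>2\<close>, and in both cases
  \<open>1 - x ^ 3 = (x + 1 / x + 1) * (x - x\<^sup>2)\<close>. This supplies the fundamental
  constant of the constructed expansion.\<close>

lemma q_eig_beta:
  fixes q :: "'a::field"
  assumes "q \<noteq> 0" "D \<noteq> 0" "X \<noteq> 0"
  shows "q_eig D \<delta> \<mu> h X - q_eig D \<delta> \<mu> h (X * q ^ 3)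
    = (q\<^sup>2 + 1 / q\<^sup>2 + 1) * (q_eig D \<delta> \<mu> h (X * q) - q_eig D \<delta> \<mu> h (X * q\<^sup>2))"
proof -
  define V W p where "V = \<mu> * X\<^sup>2 / D" and "W = h * D / X\<^sup>2" and "p = 1 / q\<^sup>2"
  have p: "p * q\<^sup>2 = 1" using assms by (simp add: p_def)
  have "q_eig D \<delta> \<mu> h (X * q ^ n) = \<delta> + V * (q\<^sup>2) ^ n + W * p ^ n" for n
    by (simp add: q_eig_def V_def W_def p_def power_mult_distrib power_divide flip: power_mult)
      (simp add: mult.commute)
  from this[of 0] this[of 1] this[of 2] this[of 3] show ?thesis
    unfolding p_def[symmetric] using p by simp algebra
qed

text \<open>The second factor decides whether two eigenvalues coincide: at \<open>X = q ^ i\<close>,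
  \<open>Y = q ^ j\<close>, \<open>D = q ^ d\<close> it vanishes iff
  \<open>\<mu> = h * q powi (2 * k)\<close> with \<open>k = d - i - j\<close>.\<close>

lemma q_eig_diff:
  fixes q :: "'a::field"
  assumes "D \<noteq> 0" "X \<noteq> 0" "Y \<noteq> 0"
  shows "q_eig D \<delta> \<mu> h X - q_eig D \<delta> \<mu> h Y = (X\<^sup>2 - Y\<^sup>2) * (\<mu> / D - h * D / (X\<^sup>2 * Y\<^sup>2))"
proof -
  define a b c where "a = 1 / X\<^sup>2" and "b = 1 / Y\<^sup>2" and "c = 1 / D"
  have "a * X\<^sup>2 = 1" "b * Y\<^sup>2 = 1" using assms by (simp_all add: a_def b_def)
  then have "(\<delta> + \<mu> * X\<^sup>2 * c + h * D * a) - (\<delta> + \<mu> * Y\<^sup>2 * c + h * D * b)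
      = (X\<^sup>2 - Y\<^sup>2) * (\<mu> * c - h * D * (a * b))"
    by algebra
  then show ?thesis by (simp add: q_eig_def a_def b_def c_def)
qed

text \<open>This is \<open>vphi i / (\<theta>s (i - 1) - \<theta>s i)\<close> at \<open>X = q ^ i\<close>. It vanishes at \<open>X = 1\<close> and at
  \<open>X = q ^ (d + 1)\<close>, so the boundary cases of the entry formulas need no special treatment; moreover
  \<open>vphi i / (\<theta>s (i - 2) - \<theta>s i)\<close> is the same quantity times \<open>q\<^sup>2 / (q\<^sup>2 + 1)\<close>.\<close>

definition q_ratio :: "'a::field \<Rightarrow> 'a \<Rightarrow> 'a \<Rightarrow> 'a \<Rightarrow> 'a \<Rightarrow> 'a \<Rightarrow> 'a" where
  "q_ratio q D \<mu> \<mu>s \<tau> X = q_fac q D X * (\<mu> - \<tau> / q_arg q D \<mu>s X) / (q - 1 / q)"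

lemma q_ratio_mult_diff:
  fixes q :: "'a::field"
  assumes "q \<noteq> 0" "D \<noteq> 0" "X \<noteq> 0" "\<mu>s \<noteq> 0" "q\<^sup>2 \<noteq> 1"
  shows "q_ratio q D \<mu> \<mu>s \<tau> (X * q) * (q_eig D \<delta>s \<mu>s 0 X - q_eig D \<delta>s \<mu>s 0 (X * q))
    = q_fac q D (X * q) * (\<tau> - \<mu> * q_arg q D \<mu>s (X * q))"
proof -
  let ?Y = "q_arg q D \<mu>s (X * q)"
  have Y: "?Y \<noteq> 0" using assms by (simp add: q_arg_def)
  have e: "q - 1 / q \<noteq> 0" using assms by (simp add: field_simps power2_eq_square)
  have "q_eig D \<delta>s \<mu>s 0 X - q_eig D \<delta>s \<mu>s 0 (X * q) = - ?Y * (q - 1 / q)"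
    using assms by (simp add: q_eig_def q_arg_def field_simps power2_eq_square)
  then have "q_ratio q D \<mu> \<mu>s \<tau> (X * q) * (q_eig D \<delta>s \<mu>s 0 X - q_eig D \<delta>s \<mu>s 0 (X * q))
      = - q_fac q D (X * q) * ((\<mu> - \<tau> / ?Y) * ?Y)"
    using e by (simp add: q_ratio_def)
  also have "(\<mu> - \<tau> / ?Y) * ?Y = \<mu> * ?Y - \<tau>" using Y by (simp add: field_simps)
  finally show ?thesis by (simp add: algebra_simps)
qed

lemma q_ratio_mult_diff2:
  fixes q :: "'a::field"
  assumes "q \<noteq> 0" "D \<noteq> 0" "X \<noteq> 0" "\<mu>s \<noteq> 0" "q\<^sup>2 \<noteq> 1" "q\<^sup>2 \<noteq> - 1"
  shows "q\<^sup>2 / (q\<^sup>2 + 1) * q_ratio q D \<mu> \<mu>s \<tau> (X * q\<^sup>2)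
      * (q_eig D \<delta>s \<mu>s 0 X - q_eig D \<delta>s \<mu>s 0 (X * q\<^sup>2))
    = q_fac q D (X * q\<^sup>2) * (\<tau> - \<mu> * q_arg q D \<mu>s (X * q\<^sup>2))"
proof -
  let ?Y = "q_arg q D \<mu>s (X * q\<^sup>2)"
  have Y: "?Y \<noteq> 0" using assms by (simp add: q_arg_def)
  have e: "q - 1 / q \<noteq> 0" using assms by (simp add: field_simps power2_eq_square)
  have p: "q\<^sup>2 + 1 \<noteq> 0" using assms by (simp add: eq_neg_iff_add_eq_0)
  have "q_eig D \<delta>s \<mu>s 0 X - q_eig D \<delta>s \<mu>s 0 (X * q\<^sup>2) = - ?Y * (q - 1 / q) * ((q\<^sup>2 + 1) / q\<^sup>2)"
    using assms by (simp add: q_eig_def q_arg_def field_simps power2_eq_square)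
  then have "q\<^sup>2 / (q\<^sup>2 + 1) * q_ratio q D \<mu> \<mu>s \<tau> (X * q\<^sup>2)
      * (q_eig D \<delta>s \<mu>s 0 X - q_eig D \<delta>s \<mu>s 0 (X * q\<^sup>2))
    = - (q_ratio q D \<mu> \<mu>s \<tau> (X * q\<^sup>2) * (q - 1 / q)) * ?Y"
    using p assms(1) by simp
  also have "q_ratio q D \<mu> \<mu>s \<tau> (X * q\<^sup>2) * (q - 1 / q) = q_fac q D (X * q\<^sup>2) * (\<mu> - \<tau> / ?Y)"
    unfolding q_ratio_def using e by simp
  also have "- (q_fac q D (X * q\<^sup>2) * (\<mu> - \<tau> / ?Y)) * ?Y = - q_fac q D (X * q\<^sup>2) * ((\<mu> - \<tau> / ?Y) * ?Y)"
    by simp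
  also have "(\<mu> - \<tau> / ?Y) * ?Y = \<mu> * ?Y - \<tau>" using Y by (simp add: field_simps)
  finally show ?thesis by (simp add: algebra_simps)
qed

text \<open>The left side is the diagonal entry \<open>M i i\<close> at \<open>X = q ^ i\<close>.
  The terms in \<open>X\<^sup>2\<close> cancel, which leaves a quadratic polynomial in
  \<open>1 / X\<^sup>2\<close> with constant term \<open>\<delta>\<close>.\<close>

lemma q_diagonal_entry:
  fixes q :: "'a::field"
  assumes "q \<noteq> 0" "D \<noteq> 0" "X \<noteq> 0" "\<mu>s \<noteq> 0" "q\<^sup>2 \<noteq> 1"
  shows "q_eig D \<delta> \<mu> h X + q_ratio q D \<mu> \<mu>s \<tau> (X * q) - q_ratio q D \<mu> \<mu>s \<tau> X
    = \<delta> + ((\<mu> + h) * D + \<tau> * (D\<^sup>2 * q\<^sup>2 + 1) / (q * \<mu>s)) * (1 / X\<^sup>2)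
        - \<tau> * D\<^sup>2 * (q\<^sup>2 + 1) / (q * \<mu>s) * (1 / X\<^sup>2)\<^sup>2"
proof -
  have e: "q * q - 1 \<noteq> 0" using assms by (simp add: power2_eq_square)
  have *: "q_ratio q D \<mu> \<mu>s \<tau> Y = q_fac q D Y * (\<mu> - \<tau> / q_arg q D \<mu>s Y) * q / (q * q - 1)" for Y
    unfolding q_ratio_def using assms e by (simp add: field_simps)
  \<comment> \<open>Naming the inverse of \<open>q * q - 1\<close> and keeping its defining equation
    leaves a polynomial identity for \<open>algebra\<close>.\<close>
  define E where "E = 1 / (q * q - 1)"
  have E: "E * (q * q - 1) = 1" using e by (simp add: E_def)
  have **: "q_ratio q D \<mu> \<mu>s \<tau> Y = q_fac q D Y * (\<mu> - \<tau> / q_arg q D \<mu>s Y) * q * E" for Y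
    unfolding * E_def by simp
  show ?thesis unfolding ** q_eig_def q_fac_def q_arg_def using assms(1-4) E
    apply (simp add: divide_simps)
    by algebra
qed

text \<open>Every term contains \<open>r (X * q)\<close>, which carries the factor
  \<open>\<mu> - \<tau> / Y\<close>; the remaining bracket turns out to be a multiple of
  \<open>h - \<tau> / Y\<close>. The symmetry in \<open>\<mu>\<close> and \<open>h\<close> is to be
  expected, since reversing the eigenvalues of \<open>A\<close> exchanges them without changing the
  matrix.\<close>

lemma q_off_diagonal_entry:
  fixes q \<mu> h \<mu>s \<tau> D X :: "'a::field"
  assumes "q \<noteq> 0" "D \<noteq> 0" "X \<noteq> 0" "\<mu>s \<noteq> 0" "q\<^sup>2 \<noteq> 1" "q\<^sup>2 \<noteq> - 1"
  defines "r \<equiv> q_ratio q D \<mu> \<mu>s \<tau>" and "\<kappa> \<equiv> q\<^sup>2 / (q\<^sup>2 + 1)" and "Y \<equiv> q_arg q D \<mu>s (X * q)"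
  shows "r (X * q) * (q_eig D \<delta> \<mu> h (X * q) - (q_eig D \<delta> \<mu> h X + r (X * q) - r X) + \<kappa> * r (X * q\<^sup>2))
      - r X * (\<kappa> * r (X * q))
    = - (D / (q * X\<^sup>2)) * q_fac q D (X * q) * ((\<mu> - \<tau> / Y) * (h - \<tau> / Y))"
proof -
  have e: "q * q - 1 \<noteq> 0" using assms by (simp add: power2_eq_square)
  have p: "q * q + 1 \<noteq> 0" using assms by (simp add: eq_neg_iff_add_eq_0 power2_eq_square)
  have *: "r Z = q_fac q D Z * (\<mu> - \<tau> / q_arg q D \<mu>s Z) * q / (q * q - 1)" for Z
    unfolding r_def q_ratio_def using assms e by (simp add: field_simps)
  have k: "\<kappa> = q * q / (q * q + 1)" "1 - \<kappa> = 1 / (q * q + 1)"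
    using p by (simp_all add: \<kappa>_def power2_eq_square field_simps)
  \<comment> \<open>The scalar \<open>(q * q - 1) / q\<close> produced here cancels the denominator
    \<open>q - 1 / q\<close> of \<open>r (X * q)\<close>.\<close>
  have core: "q_eig D \<delta> \<mu> h (X * q) - q_eig D \<delta> \<mu> h X - r (X * q) + (1 - \<kappa>) * r X + \<kappa> * r (X * q\<^sup>2)
    = - ((q * q - 1) / q) * (D / (q * X\<^sup>2)) * (h - \<tau> / Y)"
  proof -
    define E F where "E = 1 / (q * q - 1)" and "F = 1 / (q * q + 1)"
    have EF: "E * (q * q - 1) = 1" "F * (q * q + 1) = 1" using e p by (simp_all add: E_def F_def)
    have **: "r Z = q_fac q D Z * (\<mu> - \<tau> / q_arg q D \<mu>s Z) * q * E" for Z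
      unfolding * E_def by simp
    have k': "\<kappa> = q * q * F" "1 - \<kappa> = F" using k by (simp_all add: F_def)
    show ?thesis unfolding ** k' Y_def q_eig_def q_fac_def q_arg_def using assms(1-4) EF
      apply (simp add: divide_simps)
      by algebra
  qed
  have "r (X * q) * (q_eig D \<delta> \<mu> h (X * q) - (q_eig D \<delta> \<mu> h X + r (X * q) - r X) + \<kappa> * r (X * q\<^sup>2))
      - r X * (\<kappa> * r (X * q))
    = r (X * q) * (q_eig D \<delta> \<mu> h (X * q) - q_eig D \<delta> \<mu> h X - r (X * q) + (1 - \<kappa>) * r X + \<kappa> * r (X * q\<^sup>2))"
    by (simp add: algebra_simps)
  also have "\<dots> = - (D / (q * X\<^sup>2)) * q_fac q D (X * q) * ((\<mu> - \<tau> / Y) * (h - \<tau> / Y))"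
    unfolding core unfolding *[of "X * q"] Y_def[symmetric] using e assms(1) by simp
  finally show ?thesis .
qed

lemma q_fac_one: "q_fac q D 1 = 0"
  by (simp add: q_fac_def)

lemma q_fac_end: "q \<noteq> 0 \<Longrightarrow> D \<noteq> 0 \<Longrightarrow> q_fac q D (D * q) = 0"
  by (simp add: q_fac_def)

context vector_space
begin

lemma q_tridiagonal_entries:
  fixes q \<delta> \<mu> h \<delta>s \<mu>s \<tau> :: 'a
  assumes lin: "Vector_Spaces.linear scale scale A" "Vector_Spaces.linear scale scale As"
    and v: "ordered_basis scale d v" "represents scale d v As (diag \<theta>s)" "inj_on \<theta>s {..d}"
      "represents scale d v A M" "irreducible_tridiagonal d M"
    and split: "split_form scale d A As \<theta> \<theta>s vphi"
    and data: "corresponding_primary_q_data d q \<theta> \<theta>s vphi phi \<delta> \<mu> h \<delta>s \<mu>s 0 \<tau>"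
    and q: "q \<noteq> 0" "q\<^sup>2 \<noteq> 1" "q\<^sup>2 \<noteq> - 1" and \<mu>s: "\<mu>s \<noteq> 0"
  shows "i \<le> d \<Longrightarrow> M i i
      = \<delta> + ((\<mu> + h) * q ^ d + \<tau> * ((q ^ d)\<^sup>2 * q\<^sup>2 + 1) / (q * \<mu>s)) * (1 / (q ^ i)\<^sup>2)
        - \<tau> * (q ^ d)\<^sup>2 * (q\<^sup>2 + 1) / (q * \<mu>s) * (1 / (q ^ i)\<^sup>2)\<^sup>2" (is "_ \<Longrightarrow> ?diag i")
    and "i < d \<Longrightarrow> M i (i + 1) * M (i + 1) i
      = - (q ^ d / (q * (q ^ i)\<^sup>2)) * q_fac q (q ^ d) (q ^ i * q)
        * ((\<mu> - \<tau> / q_arg q (q ^ d) \<mu>s (q ^ i * q)) * (h - \<tau> / q_arg q (q ^ d) \<mu>s (q ^ i * q)))"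
      (is "_ \<Longrightarrow> ?off i")
proof -
  define D where "D = q ^ d"
  have D: "D \<noteq> 0" using q by (simp add: D_def)
  have data': "\<theta> i = q_eig D \<delta> \<mu> h (q ^ i)" "\<theta>s i = q_eig D \<delta>s \<mu>s 0 (q ^ i)" if "i \<le> d" for i
    using data that unfolding q_data_hs_zero[OF q(1)] D_def by auto
  have dv: "vphi i = q_fac q D (q ^ i) * (\<tau> - \<mu> * q_arg q D \<mu>s (q ^ i))" if "1 \<le> i" "i \<le> d" for i
    using data that unfolding q_data_hs_zero[OF q(1)] D_def by auto
  define r where "r i = q_ratio q D \<mu> \<mu>s \<tau> (q ^ i)" for i
  define s where "s i = q\<^sup>2 / (q\<^sup>2 + 1) * q_ratio q D \<mu> \<mu>s \<tau> (q ^ i)" for i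
  have qD: "q ^ (d + 1) = D * q" by (simp add: D_def)
  have z: "r 0 = 0" "r (d + 1) = 0" "s (d + 1) = 0"
    using q_fac_end[OF q(1) D] unfolding r_def s_def q_ratio_def qD by (simp_all add: q_fac_one)
  have r: "r (i + 1) * (\<theta>s i - \<theta>s (i + 1)) = vphi (i + 1)" if "i < d" for i
    using q_ratio_mult_diff[OF q(1) D _ \<mu>s q(2), of "q ^ i" \<mu> \<tau> \<delta>s] that q
    by (simp add: r_def data' dv mult.commute[of q])
  have s: "s (i + 2) * (\<theta>s i - \<theta>s (i + 2)) = vphi (i + 2)" if "i + 1 < d" for i
    using q_ratio_mult_diff2[OF q(1) D _ \<mu>s q(2,3), of "q ^ i" \<mu> \<tau> \<delta>s] that q
    by (simp only: s_def data' dv power_add) (simp add: data' dv power_add)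
  have dg0: "M i i = \<theta> i + r (i + 1) - r i" if "i \<le> d" for i
    by (rule split_form_tridiagonal_entries(1)[OF lin v split, of r s]) (use z r s that in auto)
  have off0: "M i (i + 1) * M (i + 1) i
      = r (i + 1) * (\<theta> (i + 1) - M i i + s (i + 2)) - r i * s (i + 1)" if "i < d" for i
    by (rule split_form_tridiagonal_entries(2)[OF lin v split, of r s]) (use z r s that in auto)
  show dg: "?diag i" if "i \<le> d" for i
    using dg0[OF that] q_diagonal_entry[OF q(1) D _ \<mu>s q(2), of "q ^ i" \<delta> \<mu> h \<tau>] that q
    by (simp add: r_def data' D_def mult.commute[of q])
  show "?off i" if "i < d"
  proof -
    have "M i i = q_eig D \<delta> \<mu> h (q ^ i) + r (i + 1) - r i"
      using dg0[of i] that by (simp add: data')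
    moreover have "r (i + 1) = q_ratio q D \<mu> \<mu>s \<tau> (q ^ i * q)" "r i = q_ratio q D \<mu> \<mu>s \<tau> (q ^ i)"
      "s (i + 1) = q\<^sup>2 / (q\<^sup>2 + 1) * q_ratio q D \<mu> \<mu>s \<tau> (q ^ i * q)"
      "s (i + 2) = q\<^sup>2 / (q\<^sup>2 + 1) * q_ratio q D \<mu> \<mu>s \<tau> (q ^ i * q\<^sup>2)"
      "\<theta> (i + 1) = q_eig D \<delta> \<mu> h (q ^ i * q)"
      using data'(1)[of "i + 1"] that by (simp_all add: r_def s_def power2_eq_square mult_ac)
    moreover have "q ^ i \<noteq> 0" using q by simp
    ultimately show ?thesis
      using off0[OF that] q_off_diagonal_entry[OF q(1) D _ \<mu>s q(2,3), of "q ^ i" \<mu> \<tau> \<delta> h]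
      unfolding D_def[symmetric] by metis
  qed
qed

end

section \<open>The explicit transition matrix for \<open>\<tau> = 0\<close>\<close>

text \<open>The entries \<open>\<Prod>k\<in>{i<..j}. vphi k / (\<theta>s i - \<theta>s k)\<close> of the transition matrix from an eigenbasis of
  \<open>As\<close> to the split basis, for \<open>\<tau> = 0\<close>.\<close>

definition kr_coeff :: "'a::field \<Rightarrow> 'a \<Rightarrow> 'a \<Rightarrow> nat \<Rightarrow> nat \<Rightarrow> 'a" where
  "kr_coeff q D \<mu> i j = (if j < i then 0
     else \<Prod>k\<in>{i<..j}. \<mu> * q_fac q D (q ^ k) * (q ^ k)\<^sup>2 / (q * ((q ^ k)\<^sup>2 - (q ^ i)\<^sup>2)))"

lemma kr_coeff_simps:
  "j < i \<Longrightarrow> kr_coeff q D \<mu> i j = 0"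
  "kr_coeff q D \<mu> i i = 1"
  "i \<le> j \<Longrightarrow> kr_coeff q D \<mu> i (Suc j) = kr_coeff q D \<mu> i j *
     (\<mu> * q_fac q D (q ^ Suc j) * (q ^ Suc j)\<^sup>2 / (q * ((q ^ Suc j)\<^sup>2 - (q ^ i)\<^sup>2)))"
proof -
  assume "i \<le> j"
  then have "{i<..Suc j} = insert (Suc j) {i<..j}" by auto
  then show "kr_coeff q D \<mu> i (Suc j) = kr_coeff q D \<mu> i j *
     (\<mu> * q_fac q D (q ^ Suc j) * (q ^ Suc j)\<^sup>2 / (q * ((q ^ Suc j)\<^sup>2 - (q ^ i)\<^sup>2)))"
    using \<open>i \<le> j\<close> by (simp add: kr_coeff_def)
qed (simp_all add: kr_coeff_def)

text \<open>The definition relates neighbours in a row of the matrix; this relates neighbours in a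
  column. The product telescopes: up to \<open>q\<^sup>2\<close>, the denominator of row
  \<open>i + 1\<close> at \<open>k + 1\<close> is that of row \<open>i\<close> at
  \<open>k\<close>.\<close>

lemma kr_coeff_row_step:
  fixes q :: "'a::field"
  assumes q: "q \<noteq> 0" and ne: "\<And>i j. i < j \<Longrightarrow> j \<le> d \<Longrightarrow> (q ^ j)\<^sup>2 \<noteq> (q ^ i)\<^sup>2"
    and "i < j" "j \<le> d"
  shows "kr_coeff q D \<mu> i j * (((q ^ j)\<^sup>2 - (q ^ i)\<^sup>2) * q)
    = kr_coeff q D \<mu> (Suc i) j * (\<mu> * q_fac q D (q ^ Suc i) * (q ^ j)\<^sup>2)"
  using assms(3,4)
proof (induction j)
  case (Suc j)
  have n: "(q ^ Suc j)\<^sup>2 - (q ^ i)\<^sup>2 \<noteq> 0" using ne[of i "Suc j"] Suc.prems by simp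
  show ?case
  proof (cases "i = j")
    case True
    then show ?thesis using n q by (simp add: kr_coeff_simps)
  next
    case False
    then have ij: "i < j" using Suc.prems by simp
    have n': "(q ^ j)\<^sup>2 - (q ^ i)\<^sup>2 \<noteq> 0" using ne[OF ij] Suc.prems by simp
    define f where "f = \<mu> * q_fac q D (q ^ Suc j) * (q ^ Suc j)\<^sup>2"
    have "kr_coeff q D \<mu> i (Suc j) * (((q ^ Suc j)\<^sup>2 - (q ^ i)\<^sup>2) * q) = kr_coeff q D \<mu> i j * f"
      using ij n q by (simp add: kr_coeff_simps(3) f_def del: power_Suc)
    also have "\<dots> = kr_coeff q D \<mu> (Suc i) j * (\<mu> * q_fac q D (q ^ Suc i) * (q ^ j)\<^sup>2)
        / (((q ^ j)\<^sup>2 - (q ^ i)\<^sup>2) * q) * f"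
      using Suc.IH ij Suc.prems n' q by (simp add: field_simps del: power_Suc)
    also have "\<dots> = kr_coeff q D \<mu> (Suc i) j * (f / (q * ((q ^ Suc j)\<^sup>2 - (q ^ Suc i)\<^sup>2)))
        * (\<mu> * q_fac q D (q ^ Suc i) * (q ^ Suc j)\<^sup>2)"
    proof -
      have "(q ^ Suc j)\<^sup>2 - (q ^ Suc i)\<^sup>2 = q\<^sup>2 * ((q ^ j)\<^sup>2 - (q ^ i)\<^sup>2)" "(q ^ Suc j)\<^sup>2 = q\<^sup>2 * (q ^ j)\<^sup>2"
        by (simp_all add: power_mult_distrib right_diff_distrib)
      then show ?thesis using q n' by (simp add: mult_ac del: power_Suc)
    qed
    also have "\<dots> = kr_coeff q D \<mu> (Suc i) (Suc j) * (\<mu> * q_fac q D (q ^ Suc i) * (q ^ Suc j)\<^sup>2)"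
      using ij by (simp add: kr_coeff_simps(3) f_def del: power_Suc)
    finally show ?thesis .
  qed
qed simp

text \<open>Up to a constant, \<open>q_fac q D X\<close> is
  \<open>- X\<^sup>2 / (D * q) - D * q / X\<^sup>2\<close>, so its differences factor like those of
  eigenvalues. The factor \<open>Y\<^sup>2 * q\<^sup>2 - X\<^sup>2\<close> cancels the common
  denominator in \<open>kr_coeff_conjugation\<close>.\<close>

lemma q_fac_diff:
  fixes q :: "'a::field"
  assumes "q \<noteq> 0" "D \<noteq> 0" "X \<noteq> 0" "Y \<noteq> 0"
  shows "Y\<^sup>2 * q * (q_fac q D X - q_fac q D (Y * q)) = (Y\<^sup>2 * q\<^sup>2 - X\<^sup>2) * (Y\<^sup>2 / D - D / X\<^sup>2)"
proof -
  define a b c where "a = 1 / X" and "b = 1 / (Y * q)" and "c = 1 / D"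
  have 1: "a * X = 1" "b * (Y * q) = 1" "c * D = 1" using assms by (simp_all add: a_def b_def c_def)
  have 2: "q_fac q D X = (X - a) * (D * q * a - X * c * (b * Y))"
    "q_fac q D (Y * q) = (Y * q - b) * (D * q * b - Y * q * c * (b * Y))"
    using assms by (simp_all add: q_fac_def a_def b_def c_def field_simps)
  have 3: "Y\<^sup>2 / D - D / X\<^sup>2 = Y\<^sup>2 * c - D * a\<^sup>2" by (simp add: a_def c_def power_divide)
  show ?thesis unfolding 2 3 using 1 by algebra
qed

text \<open>The tridiagonal matrix of \<open>A\<close> appears here with subdiagonal entries \<open>1\<close>, so its superdiagonal
  consists of the products of opposite off-diagonal entries. For \<open>i = 0\<close> and \<open>j = d\<close> the common
  denominator \<open>q ^ (2 * (d + 1)) - 1\<close> of the general argument may vanish.\<close>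

lemma kr_coeff_conjugation:
  fixes q \<mu> h \<delta> :: "'a::field"
  assumes q: "q \<noteq> 0" and ne: "\<And>i j. i < j \<Longrightarrow> j \<le> d \<Longrightarrow> (q ^ j)\<^sup>2 \<noteq> (q ^ i)\<^sup>2"
    and ij: "i \<le> d" "j \<le> d"
  defines "D \<equiv> q ^ d" and "R \<equiv> kr_coeff q (q ^ d) \<mu>"
  shows "(if 0 < i then R (i - 1) j else 0) + (\<delta> + (\<mu> + h) * D / (q ^ i)\<^sup>2) * R i j
      + (if i < d then - (D / (q * (q ^ i)\<^sup>2)) * q_fac q D (q ^ i * q) * (\<mu> * h) * R (i + 1) j else 0)
    = q_eig D \<delta> \<mu> h (q ^ j) * R i j + (if j < d then R i (j + 1) else 0)"
proof -
  have D: "D \<noteq> 0" using q by (simp add: D_def)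
  have R: "R = kr_coeff q D \<mu>" by (simp add: R_def D_def)
  have row: "R i j * (((q ^ j)\<^sup>2 - (q ^ i)\<^sup>2) * q)
      = R (Suc i) j * (\<mu> * q_fac q D (q ^ Suc i) * (q ^ j)\<^sup>2)" if "i < j" "j \<le> d" for i j
    unfolding R by (rule kr_coeff_row_step[OF q _ that]) (rule ne)
  consider "j + 1 < i" | "i = j + 1" | "i = 0" "j = d" | "i \<le> j" "0 < i \<or> j < d" using ij by linarith
  then show ?thesis
  proof cases
    case 1
    then show ?thesis by (simp add: R kr_coeff_simps)
  next
    case 2
    then show ?thesis using ij by (simp add: R kr_coeff_simps)
  next
    case 3
    have "R 0 d * (D\<^sup>2 - 1) * q = R 1 d * (\<mu> * q_fac q D q * D\<^sup>2)" if "0 < d"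
      using row[OF that] by (simp add: D_def mult.assoc)
    then have "R 1 d * (\<mu> * q_fac q D q) = R 0 d * (1 - 1 / D\<^sup>2) * q" if "0 < d"
      using that D by (simp add: field_simps)
    then have R1: "(D / q) * h * (R 1 d * (\<mu> * q_fac q D q)) = (D / q) * h * (R 0 d * (1 - 1 / D\<^sup>2) * q)"
      if "0 < d"
      using that by simp
    have "- (D / q) * q_fac q D q * (\<mu> * h) * R 1 d = - D * h * (R 0 d * (1 - 1 / D\<^sup>2))" if "0 < d"
    proof -
      have "- (D / q) * q_fac q D q * (\<mu> * h) * R 1 d = - ((D / q) * h * (R 1 d * (\<mu> * q_fac q D q)))"
        by (simp add: mult_ac)
      then show ?thesis unfolding R1[OF that] using q by simp
    qed
    moreover have "D = 1" if "d = 0" using that by (simp add: D_def)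
    moreover have "q_eig D \<delta> \<mu> h D = \<delta> + (\<mu> + h) * D - D * h * (1 - 1 / D\<^sup>2)"
      using D by (simp add: q_eig_def field_simps power2_eq_square)
    ultimately show ?thesis using 3
      by (cases "d = 0") (simp_all add: algebra_simps flip: D_def)
  next
    case 4
    define X Y where "X = q ^ i" and "Y = q ^ j"
    have XY: "X \<noteq> 0" "Y \<noteq> 0" using q by (simp_all add: X_def Y_def)
    \<comment> \<open>The common denominator when \<open>R (i - 1) j\<close> and
      \<open>R i (j + 1)\<close> are written as multiples of \<open>R i j\<close>. Where such a
      neighbour is missing, its formula gives zero, as \<open>q_fac\<close> vanishes at
      \<open>1\<close> and at \<open>D * q\<close>.\<close>
    define \<Delta> where "\<Delta> = Y\<^sup>2 * q\<^sup>2 - X\<^sup>2"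
    \<comment> \<open>For \<open>j < d\<close> this is a difference of squared powers with exponents
      at most \<open>d\<close>. For \<open>j = d\<close> the exponent \<open>d + 1\<close> is too
      large, so a factor \<open>q\<^sup>2\<close> is removed, which requires
      \<open>0 < i\<close>.\<close>
    have \<Delta>: "\<Delta> \<noteq> 0"
    proof (cases "j < d")
      case True
      then show ?thesis using ne[of i "Suc j"] 4 by (simp add: \<Delta>_def X_def Y_def power_mult_distrib mult.commute)
    next
      case False
      then have "0 < i" using 4 by simp
      then have "X = q ^ (i - 1) * q" by (simp add: X_def power_eq_if)
      moreover have "Y\<^sup>2 \<noteq> (q ^ (i - 1))\<^sup>2" using ne[of "i - 1" j] 4 ij \<open>0 < i\<close> by (simp add: Y_def)
      ultimately show ?thesis using q by (simp add: \<Delta>_def power_mult_distrib)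
    qed
    have t1: "(if 0 < i then R (i - 1) j else 0) = R i j * (\<mu> * q_fac q D X * Y\<^sup>2 * q / \<Delta>)"
    proof (cases "0 < i")
      case True
      then have X: "X = q ^ (i - 1) * q" by (simp add: X_def power_eq_if)
      have "\<Delta> = (Y\<^sup>2 - (q ^ (i - 1))\<^sup>2) * q * q"
        unfolding \<Delta>_def X by (simp add: power_mult_distrib left_diff_distrib power2_eq_square)
      moreover have "R (i - 1) j * ((Y\<^sup>2 - (q ^ (i - 1))\<^sup>2) * q) = R i j * (\<mu> * q_fac q D X * Y\<^sup>2)"
        using row[of "i - 1" j] True 4 ij by (simp add: X_def Y_def)
      ultimately have "R (i - 1) j * \<Delta> = R i j * (\<mu> * q_fac q D X * Y\<^sup>2) * q"
        by (simp add: mult.assoc[symmetric])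
      then show ?thesis using True q \<Delta> by (simp add: field_simps)
    next
      case False
      then show ?thesis by (simp add: X_def q_fac_one)
    qed
    have t2: "(if j < d then R i (j + 1) else 0) = R i j * (\<mu> * q_fac q D (Y * q) * Y\<^sup>2 * q / \<Delta>)"
    proof (cases "j < d")
      case True
      have *: "q ^ Suc j = Y * q" by (simp add: Y_def)
      have "R i (j + 1) = R i j * (\<mu> * q_fac q D (Y * q) * (Y * q)\<^sup>2 / (q * \<Delta>))"
        using kr_coeff_simps(3)[OF 4(1), of q D \<mu>] unfolding *
        by (simp add: R \<Delta>_def X_def power_mult_distrib)
      then show ?thesis using True q by (simp add: power2_eq_square)
    next
      case False
      then show ?thesis using ij q_fac_end[OF q D] by (simp add: Y_def D_def)
    qed
    have t3: "(if i < d then - (D / (q * X\<^sup>2)) * q_fac q D (X * q) * (\<mu> * h) * R (i + 1) j else 0)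
        = - (h * D * (1 / X\<^sup>2 - 1 / Y\<^sup>2)) * R i j"
    proof (cases "i < j")
      case True
      have *: "q ^ Suc i = X * q" by (simp add: X_def)
      have "R (i + 1) j * (\<mu> * q_fac q D (X * q)) = R i j * ((Y\<^sup>2 - X\<^sup>2) * q) / Y\<^sup>2"
        using row[OF True ij(2)] XY unfolding *
        by (simp add: X_def[symmetric] Y_def[symmetric] field_simps)
      note key = this
      have "- (D / (q * X\<^sup>2)) * q_fac q D (X * q) * (\<mu> * h) * R (i + 1) j
          = - (D / (q * X\<^sup>2)) * h * (R (i + 1) j * (\<mu> * q_fac q D (X * q)))"
        by (simp add: mult_ac)
      also have "\<dots> = - (D / (q * X\<^sup>2)) * h * (R i j * ((Y\<^sup>2 - X\<^sup>2) * q) / Y\<^sup>2)"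
        unfolding key by simp
      also have "\<dots> = - (h * D * (1 / X\<^sup>2 - 1 / Y\<^sup>2)) * R i j"
        using q XY by (simp add: field_simps)
      finally show ?thesis using True ij by simp
    next
      case False
      then have "i = j" using 4 by simp
      then show ?thesis by (simp add: R kr_coeff_simps X_def Y_def)
    qed
    have fd: "Y\<^sup>2 * q * (q_fac q D X - q_fac q D (Y * q)) / \<Delta> = Y\<^sup>2 / D - D / X\<^sup>2"
      using q_fac_diff[OF q D XY] \<Delta> by (simp add: \<Delta>_def)
    have "R i j * (\<mu> * q_fac q D X * Y\<^sup>2 * q / \<Delta>) - R i j * (\<mu> * q_fac q D (Y * q) * Y\<^sup>2 * q / \<Delta>)
        = R i j * \<mu> * (Y\<^sup>2 * q * (q_fac q D X - q_fac q D (Y * q)) / \<Delta>)"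
      by (simp add: algebra_simps diff_divide_distrib)
    also have "\<dots> = R i j * (q_eig D \<delta> \<mu> h Y) - R i j * (\<delta> + (\<mu> + h) * D / X\<^sup>2)
        + (h * D * (1 / X\<^sup>2 - 1 / Y\<^sup>2)) * R i j"
      unfolding fd by (simp add: q_eig_def algebra_simps add_divide_distrib)
    finally show ?thesis unfolding t1 t2 t3[unfolded X_def] X_def[symmetric] Y_def[symmetric] t3
      by (simp add: algebra_simps)
  qed
qed

section \<open>Near-bipartite expansions\<close>

lemma q_eig_reverse:
  fixes q :: "'a::field"
  assumes "q \<noteq> 0" "i \<le> d"
  shows "q_eig (q ^ d) \<delta> \<mu> h (q ^ (d - i)) = q_eig (q ^ d) \<delta> h \<mu> (q ^ i)"
proof -
  define X Z where "X = q ^ i" and "Z = q ^ (d - i)"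
  have "q ^ d = Z * X" using assms(2) by (simp add: X_def Z_def flip: power_add)
  moreover have "X \<noteq> 0" "Z \<noteq> 0" using assms(1) by (simp_all add: X_def Z_def)
  ultimately show ?thesis
    unfolding X_def[symmetric] Z_def[symmetric] by (simp add: q_eig_def power2_eq_square)
qed

text \<open>With vanishing last coefficient an eigenvalue depends on \<open>i\<close> only through
  \<open>q ^ (2 * i)\<close>. Distinctness of \<open>\<theta>s\<close> thereby excludes small roots
  of unity and keeps the denominators of \<open>kr_coeff\<close> and the split scalars
  nonzero.\<close>

lemma q_eig_zero_inj:
  fixes q :: "'a::field"
  assumes inj: "inj_on \<theta> {..d}" and \<theta>: "\<And>i. i \<le> d \<Longrightarrow> \<theta> i = q_eig D \<delta> \<mu> 0 (q ^ i)"
    and "i < j" "j \<le> d"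
  shows "(q ^ j)\<^sup>2 \<noteq> (q ^ i)\<^sup>2"
proof
  assume "(q ^ j)\<^sup>2 = (q ^ i)\<^sup>2"
  then have "\<theta> j = \<theta> i" using \<theta> assms(3,4) by (simp add: q_eig_def)
  then show False using inj assms(3,4) by (auto dest: inj_onD)
qed

text \<open>The two factors vanish only if \<open>q ^ (2 * i) = 1\<close> or
  \<open>q ^ (2 * (d + 1 - i)) = 1\<close>, and both \<open>i\<close> and \<open>d + 1 - i\<close>
  lie between \<open>1\<close> and \<open>d\<close>.\<close>

lemma q_fac_nonzero:
  fixes q :: "'a::field"
  assumes q: "q \<noteq> 0" and ne: "\<And>i j. i < j \<Longrightarrow> j \<le> d \<Longrightarrow> (q ^ j)\<^sup>2 \<noteq> (q ^ i)\<^sup>2"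
    and i: "1 \<le> i" "i \<le> d"
  shows "q_fac q (q ^ d) (q ^ i) \<noteq> 0"
proof
  assume "q_fac q (q ^ d) (q ^ i) = 0"
  then consider "q ^ i = 1 / q ^ i" | "q ^ d * q / q ^ i = q ^ i / (q ^ d * q)"
    by (auto simp: q_fac_def)
  then show False
  proof cases
    case 1
    then have "(q ^ i)\<^sup>2 = 1" using q by (simp add: field_simps power2_eq_square)
    then show ?thesis using ne[of 0 i] i by simp
  next
    case 2
    have "q ^ d * q = q ^ (d + 1 - i) * q ^ i" using i by (simp flip: power_add)
    then have "q ^ (d + 1 - i) = 1 / q ^ (d + 1 - i)" using 2 q by simp
    then have "(q ^ (d + 1 - i))\<^sup>2 = 1" using q by (simp add: field_simps power2_eq_square)
    moreover have "0 < d + 1 - i" "d + 1 - i \<le> d" using i by auto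
    ultimately show ?thesis using ne[of 0 "d + 1 - i"] by simp
  qed
qed

text \<open>Together with \<open>q\<^sup>2 \<noteq> 1\<close> this separates \<open>1\<close>,
  \<open>q\<^sup>2\<close> and \<open>q ^ 4\<close>, which are the points of the three-index
  comparisons up to scaling and inversion.\<close>

lemma power4_neq:
  fixes q :: "'a::field"
  assumes "q \<noteq> 0" "q\<^sup>2 \<noteq> 1" "q\<^sup>2 \<noteq> - 1"
  shows "q ^ 4 \<noteq> 1" "q\<^sup>2 \<noteq> q ^ 4"
proof -
  define p where "p = q\<^sup>2"
  have *: "q ^ 4 = p * p" by (simp add: p_def flip: power_add)
  have p: "p \<noteq> 0" "p \<noteq> 1" "p + 1 \<noteq> 0" using assms by (simp_all add: p_def eq_neg_iff_add_eq_0)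
  show "q\<^sup>2 \<noteq> q ^ 4" using p unfolding * p_def[symmetric] by simp
  have "p * p - 1 = (p - 1) * (p + 1)" by (simp add: algebra_simps)
  then show "q ^ 4 \<noteq> 1" using p unfolding * by (metis eq_iff_diff_eq_0 mult_eq_0_iff)
qed

context vector_space
begin

text \<open>Converse of \<open>q_tridiagonal_entries\<close> for \<open>\<tau> = 0\<close>: the
  prescribed entries in an eigenbasis of \<open>As\<close> determine a split basis, whose
  coordinates are \<open>kr_coeff\<close> up to a rescaling of the eigenvectors.\<close>

lemma q_split_form:
  fixes q \<delta> \<mu> h \<delta>s \<mu>s :: 'a
  assumes lin: "Vector_Spaces.linear scale scale A" "Vector_Spaces.linear scale scale As"
    and v: "ordered_basis scale d v" "represents scale d v As (diag \<theta>s)" "inj_on \<theta>s {..d}"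
      "represents scale d v A M" "irreducible_tridiagonal d M"
    and q: "q \<noteq> 0"
    and \<theta>s: "\<And>i. i \<le> d \<Longrightarrow> \<theta>s i = q_eig (q ^ d) \<delta>s \<mu>s 0 (q ^ i)"
    and \<theta>: "\<And>i. i \<le> d \<Longrightarrow> \<theta> i = q_eig (q ^ d) \<delta> \<mu> h (q ^ i)"
    and \<phi>: "\<And>i. 1 \<le> i \<Longrightarrow> i \<le> d \<Longrightarrow>
      \<phi> i = q_fac q (q ^ d) (q ^ i) * (- (\<mu> * q_arg q (q ^ d) \<mu>s (q ^ i)))"
    and dg: "\<And>i. i \<le> d \<Longrightarrow> M i i = \<delta> + (\<mu> + h) * q ^ d / (q ^ i)\<^sup>2"
    and off: "\<And>i. i < d \<Longrightarrow> M i (i + 1) * M (i + 1) i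
      = - (q ^ d / (q * (q ^ i)\<^sup>2)) * q_fac q (q ^ d) (q ^ i * q) * (\<mu> * h)"
  shows "split_form scale d A As \<theta> \<theta>s \<phi>"
proof -
  define D where "D = q ^ d"
  have D: "D \<noteq> 0" using q by (simp add: D_def)
  have ne: "(q ^ j)\<^sup>2 \<noteq> (q ^ i)\<^sup>2" if "i < j" "j \<le> d" for i j
    by (rule q_eig_zero_inj[OF v(3) \<theta>s that])
  define R where "R = kr_coeff q D \<mu>"
  \<comment> \<open>Replacing \<open>v i\<close> by \<open>g i *s v i\<close> makes the subdiagonal
    entries of \<open>M\<close> equal to \<open>1\<close>, the normalisation of
    \<open>kr_coeff_conjugation\<close>.\<close>
  define g where "g i = (\<Prod>k<i. M (Suc k) k)" for i
  have g: "g i \<noteq> 0" if "i \<le> d" for i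
    using irreducible_tridiagonalD(2)[OF v(5)] that by (auto simp: g_def)
  have gSuc: "g (Suc i) = M (Suc i) i * g i" for i by (simp add: g_def)
  define C where "C i j = g i * R i j" for i j
  define u where "u j = (\<Sum>i\<le>d. C i j *s v i)" for j
  have ub: "ordered_basis scale d u"
    by (rule ordered_basis_upper_triangular[OF v(1), where C = C])
      (use g in \<open>auto simp: u_def C_def R_def kr_coeff_simps\<close>)
  have uA: "represents scale d u A (lower_bidiagonal \<theta>)"
  proof (subst represents_change_basis_iff[OF lin(1) v(1,4) u_def], intro allI impI)
    fix i j assume ij: "i \<le> d" "j \<le> d"
    have "(if 0 < i then M i (i - 1) * C (i - 1) j else 0) = g i * (if 0 < i then R (i - 1) j else 0)"
      using gSuc[of "i - 1"] by (cases i) (simp_all add: C_def)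
    moreover have "(if i < d then M i (i + 1) * C (i + 1) j else 0)
        = g i * (if i < d then - (D / (q * (q ^ i)\<^sup>2)) * q_fac q D (q ^ i * q) * (\<mu> * h) * R (i + 1) j else 0)"
    proof (cases "i < d")
      case True
      have "M i (i + 1) * C (i + 1) j = g i * ((M i (i + 1) * M (i + 1) i) * R (i + 1) j)"
        by (simp add: C_def gSuc mult_ac)
      then show ?thesis using True unfolding off[OF True] D_def by simp
    qed simp
    moreover have "M i i * C i j = g i * ((\<delta> + (\<mu> + h) * D / (q ^ i)\<^sup>2) * R i j)"
      using dg[OF ij(1)] by (simp add: C_def D_def)
    moreover have "\<theta> j * C i j + (if j < d then C i (j + 1) else 0)
        = g i * (q_eig D \<delta> \<mu> h (q ^ j) * R i j + (if j < d then R i (j + 1) else 0))"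
      using \<theta>[OF ij(2)] by (simp add: C_def D_def algebra_simps)
    ultimately have "(if 0 < i then M i (i - 1) * C (i - 1) j else 0) + M i i * C i j
        + (if i < d then M i (i + 1) * C (i + 1) j else 0)
        = \<theta> j * C i j + (if j < d then C i (j + 1) else 0)"
      using kr_coeff_conjugation[OF q ne ij, of \<mu> \<delta> h]
      unfolding D_def[symmetric] R_def[symmetric] by (simp only: distrib_left[symmetric])
    then show "(\<Sum>k\<le>d. M i k * C k j) = (\<Sum>k\<le>d. C i k * lower_bidiagonal \<theta> k j)"
      unfolding sum_tridiagonal_mult[OF v(5) ij(1)] sum_mult_lower_bidiagonal[OF ij(2)] .
  qed
  have uAs: "represents scale d u As (upper_bidiagonal \<theta>s \<phi>)"
  proof (subst represents_change_basis_iff[OF lin(2) v(1,2) u_def], intro allI impI)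
    fix i j assume ij: "i \<le> d" "j \<le> d"
    have "\<theta>s i * C i j = \<theta>s j * C i j + (if 0 < j then \<phi> j * C i (j - 1) else 0)"
    proof (cases "i < j")
      case True
      then obtain k where k: "j = Suc k" "i \<le> k" by (cases j) auto
      define \<Delta> where "\<Delta> = (q ^ j)\<^sup>2 - (q ^ i)\<^sup>2"
      have \<Delta>: "\<Delta> \<noteq> 0" using ne[OF True ij(2)] by (simp add: \<Delta>_def)
      have "\<theta>s i - \<theta>s j = - (\<mu>s * \<Delta> / D)"
        using \<theta>s ij by (simp add: q_eig_def D_def \<Delta>_def right_diff_distrib diff_divide_distrib)
      moreover have "R i j = R i k * (\<mu> * q_fac q D (q ^ j) * (q ^ j)\<^sup>2 / (q * \<Delta>))"
        unfolding R_def \<Delta>_def k(1) by (rule kr_coeff_simps(3)[OF k(2)])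
      ultimately have "(\<theta>s i - \<theta>s j) * R i j
          = - (\<mu>s * \<Delta> / D) * (R i k * (\<mu> * q_fac q D (q ^ j) * (q ^ j)\<^sup>2 / (q * \<Delta>)))" by simp
      also have "\<dots> = \<phi> j * R i k"
        using \<phi>[of j] k ij \<Delta> by (simp add: q_arg_def D_def del: power_Suc)
      finally have "(\<theta>s i - \<theta>s j) * (g i * R i j) = \<phi> j * (g i * R i k)" by (simp add: mult_ac)
      then show ?thesis using k(1) by (simp add: C_def algebra_simps)
    next
      case False
      then show ?thesis by (cases "i = j") (auto simp: C_def R_def kr_coeff_simps)
    qed
    then show "(\<Sum>k\<le>d. diag \<theta>s i k * C k j) = (\<Sum>k\<le>d. C i k * upper_bidiagonal \<theta>s \<phi> k j)"
      using ij by (simp add: sum_diag_mult sum_mult_upper_bidiagonal)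
  qed
  show ?thesis unfolding split_form_def using ub uA uAs by blast
qed

section \<open>Necessary conditions on the parameters of \<open>B\<close> and of an
  expansion\<close>

lemma type_I_q:
  assumes "type_I scale d q A As"
  shows "q \<noteq> 0" "q\<^sup>2 \<noteq> 1" "q\<^sup>2 \<noteq> - 1"
proof -
  have *: "q \<noteq> 0" "q powi 2 + q powi (- 2) \<noteq> 2" "q powi 2 + q powi (- 2) \<noteq> - 2"
    using assms by (auto simp: type_I_def)
  show "q \<noteq> 0" by (rule *(1))
  have "q powi 2 + q powi (- 2) = q\<^sup>2 + 1 / q\<^sup>2"
    using power_int_minus_divide[of q 2] by simp
  then show "q\<^sup>2 \<noteq> 1" "q\<^sup>2 \<noteq> - 1" using *(2,3) by auto
qed

lemma standard_orderingE:
  assumes "standard_ordering scale d T X t"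
  obtains v M where "ordered_basis scale d v" "represents scale d v T (diag t)" "inj_on t {..d}"
    "represents scale d v X M" "irreducible_tridiagonal d M"
  using assms by (auto simp: standard_ordering_def bij_betw_def)

lemma bipartite_diagonal:
  assumes "bipartite scale d B As"
    and v: "ordered_basis scale d v" "represents scale d v As (diag \<theta>s)" "inj_on \<theta>s {..d}"
      "represents scale d v B M" and "i \<le> d"
  shows "M i i = 0"
proof -
  have lin: "Vector_Spaces.linear scale scale B" "Vector_Spaces.linear scale scale As"
    and fl: "flat_part scale B As = (\<lambda>w. 0)"
    using assms(1) by (auto simp: bipartite_def leonard_pair_def)
  have "flat_part scale B As (v i) = M i i *s v i"
    by (rule flat_part_diag(2)[OF lin(2) v(1-3) lin(1) v(4) \<open>i \<le> d\<close>])
  then show ?thesis using fl ordered_basis_nonzero[OF v(1) \<open>i \<le> d\<close>] by auto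
qed

text \<open>The diagonal of \<open>B\<close> is a quadratic in \<open>1 / q ^ (2 * i)\<close> that
  vanishes at \<open>i = 0, 1, 2\<close>, so its coefficients are zero. The leading one contains
  \<open>\<tau> * (q\<^sup>2 + 1)\<close>, hence \<open>\<tau> = 0\<close>; then the linear one
  reduces to \<open>(\<mu> + h) * q ^ d\<close>. For \<open>\<tau> = 0\<close> the off-diagonal
  products contain \<open>\<mu> * h\<close>, so irreducibility makes it nonzero.\<close>

lemma bipartite_q_data:
  fixes q \<delta> \<mu> h \<delta>s \<mu>s \<tau> :: 'a
  assumes d: "3 \<le> d" and bip: "bipartite scale d B As"
    and par: "parameter_array scale d B As \<theta> \<theta>s vphi phi"
    and data: "corresponding_primary_q_data d q \<theta> \<theta>s vphi phi \<delta> \<mu> h \<delta>s \<mu>s 0 \<tau>"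
    and q: "q \<noteq> 0" "q\<^sup>2 \<noteq> 1" "q\<^sup>2 \<noteq> - 1"
  shows "\<tau> = 0" "\<delta> = 0" "\<mu> + h = 0" "\<mu> * h \<noteq> 0" "\<mu>s \<noteq> 0"
proof -
  have lin: "Vector_Spaces.linear scale scale B" "Vector_Spaces.linear scale scale As"
    and std: "standard_ordering scale d As B \<theta>s" and split: "split_form scale d B As \<theta> \<theta>s vphi"
    using par by (auto simp: parameter_array_def leonard_pair_def)
  obtain v M where v: "ordered_basis scale d v" "represents scale d v As (diag \<theta>s)" "inj_on \<theta>s {..d}"
      "represents scale d v B M" "irreducible_tridiagonal d M"
    using standard_orderingE[OF std] .
  have \<theta>s: "\<theta>s i = q_eig (q ^ d) \<delta>s \<mu>s 0 (q ^ i)" if "i \<le> d" for i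
    using data that unfolding q_data_hs_zero[OF q(1)] by auto
  show \<mu>s: "\<mu>s \<noteq> 0"
  proof
    assume "\<mu>s = 0"
    then have "\<theta>s 0 = \<theta>s 1" using \<theta>s[of 0] \<theta>s[of 1] d by (simp add: q_eig_def)
    then show False using v(3) d by (auto dest: inj_onD)
  qed
  note entries = q_tridiagonal_entries[OF lin v split data q \<mu>s]
  define D where "D = q ^ d"
  have D: "D \<noteq> 0" using q by (simp add: D_def)
  define b where "b = (\<mu> + h) * D + \<tau> * (D\<^sup>2 * q\<^sup>2 + 1) / (q * \<mu>s)"
  define c where "c = - (\<tau> * D\<^sup>2 * (q\<^sup>2 + 1) / (q * \<mu>s))"
  have z: "\<delta> + b * (1 / (q ^ i)\<^sup>2) + c * (1 / (q ^ i)\<^sup>2)\<^sup>2 = 0" if "i \<le> d" for i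
    using entries(1)[OF that] bipartite_diagonal[OF bip v(1-4) that] by (simp add: b_def c_def D_def)
  note q4 = power4_neq[OF q]
  have "\<delta> = 0 \<and> b = 0 \<and> c = 0"
  proof (rule quadratic_eq_zero[OF z[of 0] z[of 1] z[of 2]])
    show "1 / (q ^ 0)\<^sup>2 \<noteq> 1 / (q ^ 1)\<^sup>2" "1 / (q ^ 0)\<^sup>2 \<noteq> 1 / (q ^ 2)\<^sup>2" "1 / (q ^ 1)\<^sup>2 \<noteq> 1 / (q ^ 2)\<^sup>2"
      using q q4 by (simp_all add: field_simps flip: power_mult power_add)
  qed (use d in simp_all)
  then have \<delta>: "\<delta> = 0" and b: "b = 0" and c: "c = 0" by auto
  show \<tau>: "\<tau> = 0" using c D \<mu>s q by (simp add: c_def eq_neg_iff_add_eq_0)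
  show "\<delta> = 0" by (rule \<delta>)
  show "\<mu> + h = 0" using b \<tau> D by (simp add: b_def)
  have "M 0 (0 + 1) * M (0 + 1) 0 \<noteq> 0" using irreducible_tridiagonalD(1,2)[OF v(5), of 0] d by simp
  then show "\<mu> * h \<noteq> 0" using entries(2)[of 0] \<tau> d by auto
qed

lemma expansion_matrix:
  assumes exp: "near_bipartite_expansion scale d B A As"
    and v: "ordered_basis scale d v" "represents scale d v As (diag \<theta>s)" "inj_on \<theta>s {..d}"
      "represents scale d v A M" "irreducible_tridiagonal d M"
  shows "represents scale d v B (\<lambda>i j. if i = j then 0 else M i j)"
    and "irreducible_tridiagonal d (\<lambda>i j. if i = j then 0 else M i j)"
proof -
  have lin: "Vector_Spaces.linear scale scale A" "Vector_Spaces.linear scale scale As"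
    and B: "B = (\<lambda>w. A w - flat_part scale A As w)"
    using exp by (auto simp: near_bipartite_expansion_def near_bipartite_def leonard_pair_def)
  show "represents scale d v B (\<lambda>i j. if i = j then 0 else M i j)"
    unfolding represents_def
  proof (intro allI impI)
    fix j assume j: "j \<le> d"
    have "B (v j) = (\<Sum>i\<le>d. M i j *s v i) - M j j *s v j"
      using flat_part_diag(2)[OF lin(2) v(1-3) lin(1) v(4) j] v(4) j by (simp add: B represents_def)
    also have "M j j *s v j = (\<Sum>i\<le>d. if i = j then M j j *s v j else 0)" using j by simp
    also have "(\<Sum>i\<le>d. M i j *s v i) - \<dots> = (\<Sum>i\<le>d. (if i = j then 0 else M i j) *s v i)"
      unfolding sum_subtractf[symmetric] by (intro sum.cong) auto
    finally show "B (v j) = (\<Sum>i\<le>d. (if i = j then 0 else M i j) *s v i)" .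
  qed
  show "irreducible_tridiagonal d (\<lambda>i j. if i = j then 0 else M i j)"
    using v(5) by (auto simp: irreducible_tridiagonal_def)
qed

text \<open>Equal off-diagonal products, divided by their common factor, give
  \<open>(\<mu> - \<tau> / Y i) * (h - \<tau> / Y i) = \<mu>' * h'\<close>. As a quadratic in
  \<open>1 / Y i\<close> with three zeros it has leading coefficient
  \<open>\<tau>\<^sup>2 = 0\<close>, and the constant term gives the product condition.\<close>

lemma expansion_conditions:
  fixes q \<delta> \<mu> h \<delta>s \<mu>s \<tau> :: 'a
  assumes d: "3 \<le> d" and bip: "bipartite scale d B As"
    and par': "parameter_array scale d B As \<theta>' \<theta>s vphi' phi'"
    and data': "corresponding_primary_q_data d q \<theta>' \<theta>s vphi' phi' \<delta>' \<mu>' h' \<delta>s \<mu>s 0 \<tau>'"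
    and q: "q \<noteq> 0" "q\<^sup>2 \<noteq> 1" "q\<^sup>2 \<noteq> - 1"
    and exp: "near_bipartite_expansion scale d B A As"
    and par: "parameter_array scale d A As \<theta> \<theta>2 vphi phi"
    and data: "corresponding_primary_q_data d q \<theta> \<theta>2 vphi phi \<delta> \<mu> h \<delta>s \<mu>s 0 \<tau>"
  shows "\<tau> = 0" "\<mu> * h = \<mu>' * h'"
    "\<And>k. 1 - int d \<le> k \<Longrightarrow> k \<le> int d - 1 \<Longrightarrow> \<mu> \<noteq> h * q powi (2 * k)"
proof -
  note B = bipartite_q_data[OF d bip par' data' q]
  have linB: "Vector_Spaces.linear scale scale B" "Vector_Spaces.linear scale scale As"
    and split': "split_form scale d B As \<theta>' \<theta>s vphi'"
    using par' by (auto simp: parameter_array_def leonard_pair_def)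
  have lin: "Vector_Spaces.linear scale scale A"
    and std: "standard_ordering scale d As A \<theta>2" "standard_ordering scale d A As \<theta>"
    and split: "split_form scale d A As \<theta> \<theta>2 vphi"
    using par by (auto simp: parameter_array_def leonard_pair_def)
  obtain v M where v: "ordered_basis scale d v" "represents scale d v As (diag \<theta>2)" "inj_on \<theta>2 {..d}"
      "represents scale d v A M" "irreducible_tridiagonal d M"
    using standard_orderingE[OF std(1)] .
  \<comment> \<open>Both data sets contain the same \<open>\<delta>s\<close> and
    \<open>\<mu>s\<close>, so the two arrays order the eigenvalues of \<open>As\<close> alike and
    one eigenbasis serves for both \<open>A\<close> and \<open>B\<close>.\<close>
  have \<theta>s: "\<theta>s i = \<theta>2 i" if "i \<le> d" for i
    using data data' that unfolding q_data_hs_zero[OF q(1)] by auto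
  have v2: "represents scale d v As (diag \<theta>s)" "inj_on \<theta>s {..d}"
    using v(2,3) \<theta>s inj_on_cong[of "{..d}" \<theta>s \<theta>2] by (auto simp: represents_diag)
  define N where "N = (\<lambda>i j. if i = j then 0 else M i j)"
  note N = expansion_matrix[OF exp v, folded N_def]
  define D where "D = q ^ d"
  define Y where "Y i = q_arg q D \<mu>s (q ^ i * q)" for i
  have Y: "Y i \<noteq> 0" for i using q B(5) by (simp add: Y_def q_arg_def D_def)
  have quad: "(\<mu> * h - \<mu>' * h') + (- \<tau> * (\<mu> + h)) * (1 / Y i) + \<tau>\<^sup>2 * (1 / Y i)\<^sup>2 = 0" if "i < d" for i
  proof -
    define f where "f = - (D / (q * (q ^ i)\<^sup>2)) * q_fac q D (q ^ i * q)"
    have 1: "M i (i + 1) * M (i + 1) i = f * ((\<mu> - \<tau> / Y i) * (h - \<tau> / Y i))"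
      using q_tridiagonal_entries(2)[OF lin linB(2) v split data q B(5) that]
      by (simp only: f_def Y_def D_def)
    have 2: "N i (i + 1) * N (i + 1) i = f * (\<mu>' * h')"
      using q_tridiagonal_entries(2)[OF linB v(1) v2 N split' data' q B(5) that] B(1)
      by (simp only: f_def Y_def D_def) simp
    have 3: "N i (i + 1) = M i (i + 1)" "N (i + 1) i = M (i + 1) i" by (simp_all add: N_def)
    have "f \<noteq> 0" using 2 3 irreducible_tridiagonalD(1,2)[OF v(5) that] by auto
    then have "(\<mu> - \<tau> / Y i) * (h - \<tau> / Y i) = \<mu>' * h'" using 1 2 3 by simp
    then show ?thesis by (simp add: algebra_simps power2_eq_square)
  qed
  note q4 = power4_neq[OF q]
  have "Y 1 = Y 0 * q\<^sup>2" "Y 2 = Y 0 * q ^ 4"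
    by (simp_all add: Y_def q_arg_def power_mult_distrib power2_eq_square power4_eq_xxxx)
  then have "1 / Y 0 \<noteq> 1 / Y 1" "1 / Y 0 \<noteq> 1 / Y 2" "1 / Y 1 \<noteq> 1 / Y 2"
    using Y[of 0] q q4 by (auto simp: field_simps power2_eq_square power4_eq_xxxx)
  from quadratic_eq_zero[OF quad[of 0] quad[of 1] quad[of 2] this] d
  show "\<tau> = 0" "\<mu> * h = \<mu>' * h'" by auto
  fix k :: int assume k: "1 - int d \<le> k" "k \<le> int d - 1"
  show "\<mu> \<noteq> h * q powi (2 * k)"
  proof
    assume eq: "\<mu> = h * q powi (2 * k)"
    \<comment> \<open>Two distinct indices with sum \<open>s = d - k\<close> are needed, where
      \<open>s\<close> lies between \<open>1\<close> and \<open>2 * d - 1\<close>. Truncated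
      subtraction gives the pair \<open>0, s\<close> for \<open>s \<le> d\<close> and the pair
      \<open>s - d, d\<close> otherwise.\<close>
    define s where "s = nat (int d - k)"
    define i where "i = s - d"
    define j where "j = s - i"
    have ij: "i \<le> d" "j \<le> d" "i \<noteq> j" "int i + int j = int d - k"
      using k by (auto simp: s_def i_def j_def)
    have "2 * k = 2 * int d - 2 * int i - 2 * int j" using ij(4) by simp
    then have "q powi (2 * k) = D\<^sup>2 / ((q ^ i)\<^sup>2 * (q ^ j)\<^sup>2)"
      using q(1) by (simp add: power_int_diff D_def flip: power_mult)
        (simp add: mult.commute power_int_of_nat[symmetric])
    then have "\<mu> / D - h * D / ((q ^ i)\<^sup>2 * (q ^ j)\<^sup>2) = 0"
      using q eq by (simp add: D_def power2_eq_square)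
    then have "q_eig D \<delta> \<mu> h (q ^ i) = q_eig D \<delta> \<mu> h (q ^ j)"
      using q_eig_diff[of D "q ^ i" "q ^ j" \<delta> \<mu> h] q by (simp add: D_def)
    then have "\<theta> i = \<theta> j"
      using data ij unfolding q_data_hs_zero[OF q(1)] D_def by auto
    then show False using std(2) ij by (auto simp: standard_ordering_def bij_betw_def dest: inj_onD)
  qed
qed

end

section \<open>Inversion of \<open>q\<close>, and the two forms of the parameter conditions\<close>

lemma corresponding_primary_q_data_inverse:
  fixes q :: "'a::field"
  shows "corresponding_primary_q_data d (inverse q) \<theta> \<theta>s vphi phi \<delta> h \<mu> \<delta>s hs \<mu>s \<tau> \<longleftrightarrow>
    corresponding_primary_q_data d q \<theta> \<theta>s vphi phi \<delta> \<mu> h \<delta>s \<mu>s hs \<tau>"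
proof -
  have inv: "inverse q powi n = q powi (- n)" for n
    by (simp add: power_int_inverse power_int_minus)
  have 1: "\<delta> + h * inverse q powi (2 * int i - int d) + \<mu> * inverse q powi (int d - 2 * int i)
      = \<delta> + \<mu> * q powi (2 * int i - int d) + h * q powi (int d - 2 * int i)" for \<delta> \<mu> h :: 'a and i
    by (simp add: inv)
  \<comment> \<open>Inverting \<open>q\<close> changes the sign of both leading factors, so their
    product stays, while the two powers in the last factor trade places.\<close>
  have 2: "(inverse q powi int i - inverse q powi (- int i)) *
      (inverse q powi (int d - int i + 1) - inverse q powi (int i - int d - 1)) *
      (\<tau> - a * inverse q powi (2 * int i - int d - 1) - b * inverse q powi (int d - 2 * int i + 1))
    = (q powi int i - q powi (- int i)) * (q powi (int d - int i + 1) - q powi (int i - int d - 1)) *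
      (\<tau> - b * q powi (2 * int i - int d - 1) - a * q powi (int d - 2 * int i + 1))" for a b :: 'a and i
  proof -
    have e: "- (int d - int i + 1) = int i - int d - 1" "- (int i - int d - 1) = int d - int i + 1"
      "- (2 * int i - int d - 1) = int d - 2 * int i + 1"
      "- (int d - 2 * int i + 1) = 2 * int i - int d - 1" "- (- int i) = int i"
      by simp_all
    show ?thesis unfolding inv e by algebra
  qed
  show ?thesis unfolding corresponding_primary_q_data_def 1 2 by (simp add: mult.commute)
qed

text \<open>Since \<open>h' = - \<mu>'\<close>, the product condition is
  \<open>\<mu> * h = - (\<mu>' * \<mu>')\<close>. Multiplying
  \<open>\<mu> = h * q powi (2 * k)\<close> by \<open>\<mu>\<close> then says that
  \<open>\<mu> / (\<mu>' * q powi k)\<close> squares to -1, and this quotient is the required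
  \<open>\<iota>\<close>.\<close>

lemma primary_parameters_iff:
  fixes q \<mu> \<mu>' :: "'a::field"
  assumes q: "q \<noteq> 0" and \<mu>': "\<mu>' \<noteq> 0" "\<mu>' + h' = 0"
  shows "(\<tau> = 0 \<and> \<mu> * h = \<mu>' * h' \<and>
      (\<forall>k. 1 - int d \<le> k \<and> k \<le> int d - 1 \<longrightarrow> \<mu> \<noteq> h * q powi (2 * k))) \<longleftrightarrow>
    (\<mu> \<noteq> 0 \<and>
      (\<forall>\<iota> i. \<iota> ^ 2 = - 1 \<and> 1 - int d \<le> i \<and> i \<le> int d - 1 \<longrightarrow> \<mu> \<noteq> \<iota> * \<mu>' * q powi i) \<and>
      \<tau> = 0 \<and> h = \<mu>' * h' / \<mu>)"
proof -
  have h': "h' = - \<mu>'" using \<mu>'(2) by (simp add: eq_neg_iff_add_eq_0 add.commute)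
  have *: "(\<exists>\<iota>. \<iota> ^ 2 = - 1 \<and> \<mu> = \<iota> * \<mu>' * q powi k) \<longleftrightarrow> \<mu> = h * q powi (2 * k)"
    if \<mu>: "\<mu> \<noteq> 0" and h: "\<mu> * h = \<mu>' * h'" for k
  proof -
    have sq: "q powi (2 * k) = q powi k * q powi k" 
      unfolding mult_2 using q by (intro power_int_add) simp
    have qk: "q powi k \<noteq> 0" using q by simp
    have hh: "\<mu> * h = - (\<mu>' * \<mu>')" using h h' by simp
    have "\<mu> = h * q powi (2 * k) \<longleftrightarrow> \<mu> * \<mu> = \<mu> * h * (q powi k * q powi k)"
      using \<mu> by (simp add: sq)
    also have "\<dots> \<longleftrightarrow> \<mu> * \<mu> = - ((\<mu>' * q powi k) * (\<mu>' * q powi k))"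
      unfolding hh by (simp add: mult_ac)
    also have "\<dots> \<longleftrightarrow> (\<exists>\<iota>. \<iota> ^ 2 = - 1 \<and> \<mu> = \<iota> * \<mu>' * q powi k)"
    proof
      assume eq: "\<mu> * \<mu> = - ((\<mu>' * q powi k) * (\<mu>' * q powi k))"
      have "(\<mu> / (\<mu>' * q powi k))\<^sup>2 = - 1"
        using eq qk \<mu>'(1) by (simp add: power_divide power2_eq_square)
      moreover have "\<mu> = \<mu> / (\<mu>' * q powi k) * \<mu>' * q powi k" using qk \<mu>'(1) by simp
      ultimately show "\<exists>\<iota>. \<iota> ^ 2 = - 1 \<and> \<mu> = \<iota> * \<mu>' * q powi k" by blast
    next
      assume "\<exists>\<iota>. \<iota> ^ 2 = - 1 \<and> \<mu> = \<iota> * \<mu>' * q powi k"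
      then obtain \<iota> where "\<iota> ^ 2 = - 1" "\<mu> = \<iota> * \<mu>' * q powi k" by blast
      then show "\<mu> * \<mu> = - ((\<mu>' * q powi k) * (\<mu>' * q powi k))" by algebra
    qed
    finally show ?thesis by blast
  qed
  have "\<mu> * h = \<mu>' * h' \<longleftrightarrow> \<mu> \<noteq> 0 \<and> h = \<mu>' * h' / \<mu>"
  proof
    assume eq: "\<mu> * h = \<mu>' * h'"
    then have "\<mu> \<noteq> 0" using \<mu>'(1) h' by auto
    then show "\<mu> \<noteq> 0 \<and> h = \<mu>' * h' / \<mu>" using eq by (simp add: field_simps)
  qed auto
  then show ?thesis using * by blast
qed

context vector_space
begin

lemma type_I_inverse: "type_I scale d (inverse q) A As \<longleftrightarrow> type_I scale d q A As"
proof -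
  have "inverse q powi 2 + inverse q powi (- 2) = q powi 2 + q powi (- 2)"
    by (simp add: power_int_inverse power_int_minus power_inverse add.commute)
  then show ?thesis by (simp add: type_I_def)
qed

lemma primary_q_data_inverse:
  "primary_q_data scale d (inverse q) A As \<delta> h \<mu> \<delta>s hs \<mu>s \<tau> \<longleftrightarrow>
    primary_q_data scale d q A As \<delta> \<mu> h \<delta>s \<mu>s hs \<tau>"
  by (simp add: primary_q_data_def type_I_inverse corresponding_primary_q_data_inverse)

lemma dual_q_Krawtchouk_inverse:
  "dual_q_Krawtchouk scale d (inverse q) A As \<longleftrightarrow> dual_q_Krawtchouk scale d q A As"
  by (simp add: dual_q_Krawtchouk_def type_I_inverse)

text \<open>The type is witnessed by some ordering \<open>t\<close>, which is
  \<open>\<theta>s\<close> or its reversal; reversal exchanges \<open>\<mu>s\<close> and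
  \<open>hs\<close> and keeps their product. The constant ratio makes the first three differences of
  \<open>t\<close> geometric, which a sum of two geometric sequences with distinct ratios
  \<open>q\<^sup>2\<close> and \<open>1 / q\<^sup>2\<close> allows only if one of them is
  absent.\<close>

lemma dual_q_Krawtchouk_geometric:
  fixes q \<delta>s \<mu>s hs :: 'a
  assumes d: "3 \<le> d" and dual: "dual_q_Krawtchouk scale d q B As"
    and std: "standard_ordering scale d As B \<theta>s"
    and \<theta>s: "\<And>i. i \<le> d \<Longrightarrow> \<theta>s i = q_eig (q ^ d) \<delta>s \<mu>s hs (q ^ i)"
  shows "\<mu>s = 0 \<or> hs = 0"
proof -
  obtain \<theta> t vphi phi c where par: "parameter_array scale d B As \<theta> t vphi phi"
    and c: "\<And>i. 1 \<le> i \<Longrightarrow> i \<le> d - 1 \<Longrightarrow> (t (i - 1) - t i) / (t i - t (i + 1)) = c"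
    and tI: "type_I scale d q B As"
    using dual by (auto simp: dual_q_Krawtchouk_def)
  note q = type_I_q[OF tI]
  have lin: "Vector_Spaces.linear scale scale B" "Vector_Spaces.linear scale scale As"
    and std_t: "standard_ordering scale d As B t"
    using par by (auto simp: parameter_array_def leonard_pair_def)
  have "(\<forall>i\<le>d. t i = \<theta>s i) \<or> (\<forall>i\<le>d. t i = \<theta>s (d - i))"
    using standard_ordering_unique[OF _ lin(2,1) std std_t] d by simp
  then obtain a b where ab: "a * b = \<mu>s * hs" "\<And>i. i \<le> d \<Longrightarrow> t i = q_eig (q ^ d) \<delta>s a b (q ^ i)"
  proof
    assume "\<forall>i\<le>d. t i = \<theta>s i"
    then show thesis using that[of \<mu>s hs] \<theta>s by simp
  next
    assume "\<forall>i\<le>d. t i = \<theta>s (d - i)"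
    then show thesis using that[of hs \<mu>s] \<theta>s q_eig_reverse[OF q(1), of _ d \<delta>s \<mu>s hs]
      by (simp add: mult.commute)
  qed
  have inj: "inj_on t {..d}" using std_t by (simp add: standard_ordering_def bij_betw_def)
  have ne: "t 1 - t 2 \<noteq> 0" "t 2 - t 3 \<noteq> 0" using inj d by (auto dest: inj_onD)
  have "(t 0 - t 1) / (t 1 - t 2) = c" "(t 1 - t 2) / (t 2 - t 3) = c"
    using c[of 1] c[of 2] d by (simp_all add: eval_nat_numeral)
  then have "t 0 - t 1 = c * (t 1 - t 2)" "t 1 - t 2 = c * (t 2 - t 3)"
    using ne by (simp_all only: nonzero_divide_eq_eq simp_thms)
  then have eq: "(t 0 - t 1) * (t 2 - t 3) = (t 1 - t 2) * (t 1 - t 2)" by algebra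
  define D V W p where "D = q ^ d" and "V = a / D" and "W = b * D" and "p = 1 / q\<^sup>2"
  have D: "D \<noteq> 0" using q by (simp add: D_def)
  have p: "p * q\<^sup>2 = 1" using q by (simp add: p_def)
  have t: "t i = \<delta>s + V * (q\<^sup>2) ^ i + W * p ^ i" if "i \<le> d" for i
    using ab(2)[OF that]
    by (simp add: q_eig_def V_def W_def p_def D_def power_divide flip: power_mult)
      (simp add: mult.commute)
  define s where "s = q\<^sup>2"
  have ps: "p * s = 1" and s1: "1 - s \<noteq> 0" using p q by (simp_all add: s_def)
  have "t 0 = \<delta>s + V + W" "t 1 = \<delta>s + V * s + W * p" "t 2 = \<delta>s + V * s\<^sup>2 + W * p\<^sup>2"
    "t 3 = \<delta>s + V * s ^ 3 + W * p ^ 3"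
    using t[of 0] t[of 1] t[of 2] t[of 3] d by (simp_all add: s_def)
  then have "t 0 - t 1 = (1 - s) * (V - W * p)" "t 1 - t 2 = (1 - s) * (V * s - W * p\<^sup>2)"
    "t 2 - t 3 = (1 - s) * (V * s\<^sup>2 - W * p ^ 3)"
    using ps by algebra+
  then have "(V - W * p) * (V * s\<^sup>2 - W * p ^ 3) = (V * s - W * p\<^sup>2) * (V * s - W * p\<^sup>2)"
    using eq s1 by simp
  \<comment> \<open>The squares of \<open>V\<close> and of \<open>W\<close> cancel in the previous
    equation; only the mixed term is left.\<close>
  then have "V * W * (p * (p - s)\<^sup>2) = 0" using ps by algebra
  moreover have "p \<noteq> 0" using ps by auto
  moreover have "p \<noteq> s" using ps power4_neq(1)[OF q] by (auto simp: s_def simp flip: power_add)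
  ultimately have "V * W = 0" by simp
  then show ?thesis using ab(1) D by (auto simp: V_def W_def)
qed

text \<open>For \<open>hs = 0\<close> and \<open>\<tau> = 0\<close> the split sequences are the same
  nonzero scalars times \<open>- \<mu>\<close> and \<open>- h\<close>, so their quotient is
  \<open>\<mu> / h\<close>.\<close>

lemma dual_q_KrawtchoukI:
  fixes q \<delta> \<mu> h \<delta>s \<mu>s :: 'a
  assumes tI: "type_I scale d q A As"
    and par: "parameter_array scale d A As \<theta> \<theta>s vphi phi"
    and data: "corresponding_primary_q_data d q \<theta> \<theta>s vphi phi \<delta> \<mu> h \<delta>s \<mu>s 0 0"
    and nz: "\<mu>s \<noteq> 0" "\<mu> * h \<noteq> 0"
  shows "dual_q_Krawtchouk scale d q A As"
proof -
  note q = type_I_q[OF tI]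
  define D where "D = q ^ d"
  have D: "D \<noteq> 0" using q by (simp add: D_def)
  have \<theta>s: "\<theta>s i = q_eig D \<delta>s \<mu>s 0 (q ^ i)" if "i \<le> d" for i
    using data that unfolding q_data_hs_zero[OF q(1)] D_def by auto
  have ph: "vphi i = q_fac q D (q ^ i) * (0 - \<mu> * q_arg q D \<mu>s (q ^ i))"
    "phi i = q_fac q D (q ^ i) * (0 - h * q_arg q D \<mu>s (q ^ i))" if "1 \<le> i" "i \<le> d" for i
    using data that unfolding q_data_hs_zero[OF q(1)] D_def by auto
  have inj: "inj_on \<theta>s {..d}"
    using par by (simp add: parameter_array_def standard_ordering_def bij_betw_def)
  have ne: "(q ^ j)\<^sup>2 \<noteq> (q ^ i)\<^sup>2" if "i < j" "j \<le> d" for i j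
    by (rule q_eig_zero_inj[OF inj \<theta>s that])
  have "(\<theta>s (i - 1) - \<theta>s i) / (\<theta>s i - \<theta>s (i + 1)) = 1 / q\<^sup>2" if i: "1 \<le> i" "i \<le> d - 1" for i
  proof -
    obtain k where k: "i = Suc k" using i by (cases i) auto
    have "\<theta>s i - \<theta>s (i + 1) = (\<theta>s (i - 1) - \<theta>s i) * q\<^sup>2"
      using i by (simp add: \<theta>s k q_eig_def power_mult_distrib algebra_simps diff_divide_distrib)
    moreover have "\<theta>s (i - 1) - \<theta>s i \<noteq> 0" using inj i k by (auto dest: inj_onD)
    ultimately show ?thesis by simp
  qed
  moreover have "vphi i / phi i = \<mu> / h" if "1 \<le> i" "i \<le> d" for i
  proof -
    have "q_fac q D (q ^ i) \<noteq> 0" unfolding D_def by (rule q_fac_nonzero[OF q(1) ne that])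
    moreover have "q_arg q D \<mu>s (q ^ i) \<noteq> 0" using nz q D by (simp add: q_arg_def)
    ultimately show ?thesis using ph[OF that] nz by simp
  qed
  ultimately show ?thesis unfolding dual_q_Krawtchouk_def using tI par by blast
qed

section \<open>Construction of the expansion\<close>

lemma expansion_exists:
  fixes q \<delta> \<mu> h \<delta>s \<mu>s :: 'a
  assumes d: "3 \<le> d" and bip: "bipartite scale d B As" and tI: "type_I scale d q B As"
    and par': "parameter_array scale d B As \<theta>' \<theta>s vphi' phi'"
    and data': "corresponding_primary_q_data d q \<theta>' \<theta>s vphi' phi' \<delta>' \<mu>' h' \<delta>s \<mu>s 0 \<tau>'"
    and \<mu>h: "\<mu> * h = \<mu>' * h'"
    and dist: "\<And>k. 1 - int d \<le> k \<Longrightarrow> k \<le> int d - 1 \<Longrightarrow> \<mu> \<noteq> h * q powi (2 * k)"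
  shows "\<exists>A. near_bipartite_expansion scale d B A As \<and>
    primary_q_data scale d q A As \<delta> \<mu> h \<delta>s \<mu>s 0 0"
proof -
  interpret p: vector_space_pair scale scale by unfold_locales
  note q = type_I_q[OF tI]
  note B = bipartite_q_data[OF d bip par' data' q]
  have linB: "Vector_Spaces.linear scale scale B" "Vector_Spaces.linear scale scale As"
    and stdB: "standard_ordering scale d As B \<theta>s"
    and split': "split_form scale d B As \<theta>' \<theta>s vphi'" and leoB: "leonard_pair scale d B As"
    using par' by (auto simp: parameter_array_def leonard_pair_def)
  obtain v N where v: "ordered_basis scale d v" "represents scale d v As (diag \<theta>s)" "inj_on \<theta>s {..d}"
      and N: "represents scale d v B N" "irreducible_tridiagonal d N"
    using standard_orderingE[OF stdB] .
  define D where "D = q ^ d"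
  have D: "D \<noteq> 0" using q by (simp add: D_def)
  have \<theta>s: "\<theta>s i = q_eig (q ^ d) \<delta>s \<mu>s 0 (q ^ i)" if "i \<le> d" for i
    using data' that unfolding q_data_hs_zero[OF q(1)] by auto
  have ne: "(q ^ j)\<^sup>2 \<noteq> (q ^ i)\<^sup>2" if "i < j" "j \<le> d" for i j
    by (rule q_eig_zero_inj[OF v(3) \<theta>s that])
  \<comment> \<open>The diagonal that \<open>q_diagonal_entry\<close> forces on an expansion with
    \<open>\<tau> = 0\<close>.\<close>
  define f where "f i = \<delta> + (\<mu> + h) * q ^ d / (q ^ i)\<^sup>2" for i
  obtain F where F: "Vector_Spaces.linear scale scale F" "\<And>j. j \<le> d \<Longrightarrow> F (v j) = f j *s v j"
    using linear_extend_ordered_basis[OF v(1), of "\<lambda>j. f j *s v j"] by metis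
  define A where "A w = B w + F w" for w
  have A_eq: "A = (\<lambda>w. B w + F w)" by (simp add: A_def fun_eq_iff)
  have lin: "Vector_Spaces.linear scale scale A"
    unfolding A_eq by (rule p.linear_compose_add[OF linB(1) F(1)])
  define M where "M i j = (if i = j then f i else N i j)" for i j
  have M: "represents scale d v A M"
    unfolding represents_def
  proof (intro allI impI)
    fix j assume j: "j \<le> d"
    have "(\<Sum>i\<le>d. M i j *s v i) = (\<Sum>i\<le>d. N i j *s v i) + (\<Sum>i\<le>d. if i = j then f j *s v j else 0)"
      unfolding sum.distrib[symmetric]
      by (intro sum.cong) (auto simp: M_def bipartite_diagonal[OF bip v N(1)])
    then show "A (v j) = (\<Sum>i\<le>d. M i j *s v i)"
      using N(1) j F(2) by (simp add: A_def represents_def)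
  qed
  have Mirr: "irreducible_tridiagonal d M"
    using N(2) by (auto simp: irreducible_tridiagonal_def M_def)
  \<comment> \<open>The off-diagonal entries are those of \<open>B\<close>, and
    \<open>\<mu>' * h'\<close> may be replaced by \<open>\<mu> * h\<close>.\<close>
  have off: "M i (i + 1) * M (i + 1) i = - (q ^ d / (q * (q ^ i)\<^sup>2)) * q_fac q (q ^ d) (q ^ i * q) * (\<mu> * h)"
    if "i < d" for i
    using q_tridiagonal_entries(2)[OF linB v N split' data' q B(5) that] B(1) by (simp add: M_def \<mu>h)
  have dg: "M i i = \<delta> + (\<mu> + h) * q ^ d / (q ^ i)\<^sup>2" for i by (simp add: M_def f_def)
  define \<theta> where "\<theta> i = q_eig (q ^ d) \<delta> \<mu> h (q ^ i)" for i
  define vphi where "vphi i = q_fac q (q ^ d) (q ^ i) * (- (\<mu> * q_arg q (q ^ d) \<mu>s (q ^ i)))" for i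
  define phi where "phi i = q_fac q (q ^ d) (q ^ i) * (- (h * q_arg q (q ^ d) \<mu>s (q ^ i)))" for i
  have split1: "split_form scale d A As \<theta> \<theta>s vphi"
    by (rule q_split_form[OF lin linB(2) v M Mirr q(1) \<theta>s \<theta>_def vphi_def dg off])
  \<comment> \<open>Reversing \<open>\<theta>\<close> exchanges \<open>\<mu>\<close> and
    \<open>h\<close>, and the diagonal and the off-diagonal products of \<open>M\<close> are
    symmetric in them, so the same matrix also yields this split form.\<close>
  have split2: "split_form scale d A As (\<lambda>i. \<theta> (d - i)) \<theta>s phi"
  proof (rule q_split_form[OF lin linB(2) v M Mirr q(1) \<theta>s _ phi_def])
    show "\<theta> (d - i) = q_eig (q ^ d) \<delta> h \<mu> (q ^ i)" if "i \<le> d" for i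
      unfolding \<theta>_def by (rule q_eig_reverse[OF q(1) that])
  qed (use dg off in \<open>auto simp: add.commute[of h] mult.commute[of h]\<close>)
  have nz: "q_fac q (q ^ d) (q ^ i) \<noteq> 0" "q_arg q (q ^ d) \<mu>s (q ^ i) \<noteq> 0" if "1 \<le> i" "i \<le> d" for i
    using q_fac_nonzero[OF q(1) ne that] q B(5) by (simp_all add: q_arg_def)
  have \<mu>h0: "\<mu> \<noteq> 0" "h \<noteq> 0" using \<mu>h B(4) by auto
  have inj\<theta>: "inj_on \<theta> {..d}"
  proof (rule inj_onI, rule ccontr)
    fix i j assume ij: "i \<in> {..d}" "j \<in> {..d}" "\<theta> i = \<theta> j" "i \<noteq> j"
    have "((q ^ i)\<^sup>2 - (q ^ j)\<^sup>2) * (\<mu> / D - h * D / ((q ^ i)\<^sup>2 * (q ^ j)\<^sup>2)) = 0"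
      using q_eig_diff[OF D, of "q ^ i" "q ^ j" \<delta> \<mu> h] ij(3) q by (simp add: \<theta>_def D_def)
    moreover have "(q ^ i)\<^sup>2 \<noteq> (q ^ j)\<^sup>2" using ne[of i j] ne[of j i] ij by (auto simp: nat_neq_iff)
    ultimately have "\<mu> / D = h * D / ((q ^ i)\<^sup>2 * (q ^ j)\<^sup>2)" by simp
    then have "\<mu> = h * (D\<^sup>2 / ((q ^ i)\<^sup>2 * (q ^ j)\<^sup>2))"
      using D by (simp add: divide_eq_eq power2_eq_square mult_ac)
    moreover define k where "k = int d - int i - int j"
    have "2 * k = 2 * int d - 2 * int i - 2 * int j" by (simp add: k_def)
    then have "q powi (2 * k) = D\<^sup>2 / ((q ^ i)\<^sup>2 * (q ^ j)\<^sup>2)"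
      using q(1) by (simp add: power_int_diff D_def flip: power_mult)
        (simp add: mult.commute power_int_of_nat[symmetric])
    ultimately show False using dist[of k] ij by (auto simp: k_def)
  qed
  obtain w N' where w: "ordered_basis scale d w" "represents scale d w A (diag \<theta>)"
      "represents scale d w As N'" "irreducible_tridiagonal d N'"
  proof (rule split_forms_eigenbasis[OF lin linB(2) inj\<theta> split1 split2])
    show "vphi i \<noteq> 0" "phi i \<noteq> 0" if "1 \<le> i" "i \<le> d" for i
      using nz[OF that] \<mu>h0 by (simp_all add: vphi_def phi_def)
  qed
  have dm: "diagonal_matrix d (diag t)" for t :: "nat \<Rightarrow> 'a" by (simp add: diagonal_matrix_def diag_def)
  have leo: "leonard_pair scale d A As"
    unfolding leonard_pair_def using lin linB(2) v(1,2) M Mirr w dm by blast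
  have std: "standard_ordering scale d A As \<theta>"
    unfolding standard_ordering_def eigenvalues_diag[OF lin w(1,2)]
    using inj\<theta> w by (auto simp: bij_betw_def)
  have std': "standard_ordering scale d As A \<theta>s"
    using stdB v(1,2) M Mirr unfolding standard_ordering_def by blast
  have par: "parameter_array scale d A As \<theta> \<theta>s vphi phi"
    unfolding parameter_array_def using leo std std' split1 split2 by blast
  have data: "corresponding_primary_q_data d q \<theta> \<theta>s vphi phi \<delta> \<mu> h \<delta>s \<mu>s 0 0"
    unfolding q_data_hs_zero[OF q(1)] by (simp add: \<theta>_def \<theta>s vphi_def phi_def)
  \<comment> \<open>Both maps multiply \<open>v j\<close> by \<open>f j\<close>, the diagonal of
    \<open>M\<close>. Removing the flat part therefore returns \<open>B\<close> itself, whose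
    Leonard property is given.\<close>
  have "flat_part scale A As = F"
    by (rule linear_eq_on_ordered_basis[OF flat_part_diag(1)[OF linB(2) v lin M] F(1) v(1)])
      (simp add: flat_part_diag(2)[OF linB(2) v lin M] F(2) M_def)
  then have "(\<lambda>w. A w - flat_part scale A As w) = B" by (simp add: A_def)
  then have exp: "near_bipartite_expansion scale d B A As"
    using leo leoB by (simp add: near_bipartite_expansion_def near_bipartite_def)
  obtain \<beta> where \<beta>: "\<beta> \<noteq> 2" "\<beta> \<noteq> - 2" "\<beta> = q powi 2 + q powi (- 2)"
    using tI by (auto simp: type_I_def)
  have \<beta>q: "\<beta> + 1 = q\<^sup>2 + 1 / q\<^sup>2 + 1" using power_int_minus_divide[of q 2] by (simp add: \<beta>(3))
  \<comment> \<open>Every sequence of the form \<open>q_eig\<close> has this quotient, so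
    \<open>\<theta>\<close> and \<open>\<theta>s\<close> share the constant \<open>\<beta>\<close>
    given by \<open>q\<close>, and \<open>A, As\<close> has type I.\<close>
  have ratio: "(t (i - 2) - t (i + 1)) / (t (i - 1) - t i) = \<beta> + 1"
    if t: "inj_on t {..d}" "\<And>i. i \<le> d \<Longrightarrow> t i = q_eig (q ^ d) x y z (q ^ i)"
      and i: "2 \<le> i" "i \<le> d - 1" for t x y z i
  proof -
    obtain n where n: "i = n + 2" using i(1) by (metis add.commute le_Suc_ex)
    have "q_eig (q ^ d) x y z (q ^ n) - q_eig (q ^ d) x y z (q ^ n * q ^ 3)
        = (\<beta> + 1) * (q_eig (q ^ d) x y z (q ^ n * q) - q_eig (q ^ d) x y z (q ^ n * q\<^sup>2))"
      unfolding \<beta>q using q by (intro q_eig_beta) simp_all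
    moreover have "t (i - 2) = q_eig (q ^ d) x y z (q ^ n)" "t (i + 1) = q_eig (q ^ d) x y z (q ^ n * q ^ 3)"
      "t (i - 1) = q_eig (q ^ d) x y z (q ^ n * q)" "t i = q_eig (q ^ d) x y z (q ^ n * q\<^sup>2)"
      using i d by (simp_all add: t(2) n power2_eq_square power3_eq_cube mult_ac)
    moreover have "t (i - 1) - t i \<noteq> 0" using t(1) i by (auto dest: inj_onD)
    ultimately show ?thesis by simp
  qed
  have "fundamental_constant scale d A As \<beta>"
    unfolding fundamental_constant_def using d leo std std' ratio[OF inj\<theta> \<theta>_def] ratio[OF v(3) \<theta>s] by blast
  then have "type_I scale d q A As" unfolding type_I_def using \<beta> q(1) by blast
  then show ?thesis unfolding primary_q_data_def using exp par data by blast
qed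

text \<open>The eigenvalue condition keeps the form
  \<open>\<mu> \<noteq> h * q powi (2 * k)\<close>, which is invariant under exchanging
  \<open>\<mu>\<close> with \<open>h\<close> and \<open>q\<close> with its inverse; the first two
  conclusions later feed \<open>primary_parameters_iff\<close>.\<close>

lemma near_bipartite_expansion_hs_zero:
  fixes q \<delta> \<mu> h \<delta>s \<mu>s \<tau> :: 'a
  assumes d: "3 \<le> d" and bip: "bipartite scale d B As" and tI: "type_I scale d q B As"
    and par': "parameter_array scale d B As \<theta>' \<theta>s vphi' phi'"
    and data': "corresponding_primary_q_data d q \<theta>' \<theta>s vphi' phi' \<delta>' \<mu>' h' \<delta>s \<mu>s 0 \<tau>'"
  shows "\<mu>' \<noteq> 0" "\<mu>' + h' = 0"
    and "(\<exists>A. near_bipartite_expansion scale d B A As \<and>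
        primary_q_data scale d q A As \<delta> \<mu> h \<delta>s \<mu>s 0 \<tau>) \<longleftrightarrow>
      \<tau> = 0 \<and> \<mu> * h = \<mu>' * h' \<and>
      (\<forall>k. 1 - int d \<le> k \<and> k \<le> int d - 1 \<longrightarrow> \<mu> \<noteq> h * q powi (2 * k))"
    and "near_bipartite_expansion scale d B A As \<Longrightarrow>
      primary_q_data scale d q A As \<delta> \<mu> h \<delta>s \<mu>s 0 \<tau> \<Longrightarrow> dual_q_Krawtchouk scale d q A As"
proof -
  note q = type_I_q[OF tI]
  note B = bipartite_q_data[OF d bip par' data' q]
  show "\<mu>' \<noteq> 0" "\<mu>' + h' = 0" using B by auto
  note nec = expansion_conditions[OF d bip par' data' q]
  show "(\<exists>A. near_bipartite_expansion scale d B A As \<and>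
        primary_q_data scale d q A As \<delta> \<mu> h \<delta>s \<mu>s 0 \<tau>) \<longleftrightarrow>
      \<tau> = 0 \<and> \<mu> * h = \<mu>' * h' \<and>
      (\<forall>k. 1 - int d \<le> k \<and> k \<le> int d - 1 \<longrightarrow> \<mu> \<noteq> h * q powi (2 * k))" (is "?L \<longleftrightarrow> ?R")
  proof
    assume ?L
    then obtain A \<theta> \<theta>2 vphi phi where "near_bipartite_expansion scale d B A As"
        "parameter_array scale d A As \<theta> \<theta>2 vphi phi"
        "corresponding_primary_q_data d q \<theta> \<theta>2 vphi phi \<delta> \<mu> h \<delta>s \<mu>s 0 \<tau>"
      by (auto simp: primary_q_data_def)
    from nec[OF this] show ?R by blast
  next
    assume ?R
    then show ?L using expansion_exists[OF d bip tI par' data', of \<mu> h \<delta>] by blast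
  qed
  assume exp: "near_bipartite_expansion scale d B A As"
    and "primary_q_data scale d q A As \<delta> \<mu> h \<delta>s \<mu>s 0 \<tau>"
  then obtain \<theta> \<theta>2 vphi phi where A: "type_I scale d q A As"
      "parameter_array scale d A As \<theta> \<theta>2 vphi phi"
      "corresponding_primary_q_data d q \<theta> \<theta>2 vphi phi \<delta> \<mu> h \<delta>s \<mu>s 0 \<tau>"
    by (auto simp: primary_q_data_def)
  have \<tau>: "\<tau> = 0" and "\<mu> * h = \<mu>' * h'" by (rule nec[OF exp A(2,3)])+
  then have "\<mu> * h \<noteq> 0" using B(4) by simp
  then show "dual_q_Krawtchouk scale d q A As"
    by (rule dual_q_KrawtchoukI[OF A(1,2) A(3)[unfolded \<tau>] B(5)])
qed

end

theorem theorem26p1: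
  fixes scale :: "'a::alg_closed_field \<Rightarrow> 'v::ab_group_add \<Rightarrow> 'v"
    and d :: nat and q :: 'a
    and B As :: "'v \<Rightarrow> 'v"
    and \<theta>' \<theta>s vphi' phi' :: "nat \<Rightarrow> 'a"
    and \<delta>' \<mu>' h' \<delta>s \<mu>s hs \<tau>' :: 'a
    and \<delta> \<mu> h \<tau> :: 'a
  assumes "CHAR('a) \<noteq> 2"
    and "d \<ge> 3"
    and "vector_space scale"
    and "vector_space.dim scale (UNIV :: 'v set) = d + 1"
    and "bipartite scale d B As"
    and "reinforced_dual_q_Krawtchouk scale d q B As"
    and "parameter_array scale d B As \<theta>' \<theta>s vphi' phi'"
    and "corresponding_primary_q_data d q \<theta>' \<theta>s vphi' phi' \<delta>' \<mu>' h' \<delta>s \<mu>s hs \<tau>'"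
  shows
    "((\<exists>A. near_bipartite_expansion scale d B A As \<and>
           primary_q_data scale d q A As \<delta> \<mu> h \<delta>s \<mu>s hs \<tau>)
      \<longleftrightarrow>
      (\<mu> \<noteq> 0 \<and>
       (\<forall>\<iota> i. \<iota> ^ 2 = - 1 \<and> 1 - int d \<le> i \<and> i \<le> int d - 1 \<longrightarrow> \<mu> \<noteq> \<iota> * \<mu>' * q powi i) \<and>
       \<tau> = 0 \<and>
       h = \<mu>' * h' / \<mu>))
     \<and>
     (\<forall>A. near_bipartite_expansion scale d B A As \<and>
          primary_q_data scale d q A As \<delta> \<mu> h \<delta>s \<mu>s hs \<tau> \<longrightarrow>
          reinforced_dual_q_Krawtchouk scale d q A As)"
proof -
  interpret V: vector_space scale by fact
  note d = assms(2) and bip = assms(5) and par = assms(7) and data = assms(8)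
  have dual: "dual_q_Krawtchouk scale d q B As"
    and reinf: "\<forall>i. 1 \<le> i \<and> i \<le> d - 1 \<longrightarrow> q ^ (2 * i) \<noteq> - 1"
    using assms(6) by (auto simp: reinforced_dual_q_Krawtchouk_def)
  have tI: "type_I scale d q B As" using dual by (simp add: dual_q_Krawtchouk_def)
  note q = V.type_I_q[OF tI]
  have std: "standard_ordering scale d As B \<theta>s" using par by (simp add: parameter_array_def)
  have "\<theta>s i = q_eig (q ^ d) \<delta>s \<mu>s hs (q ^ i)" if "i \<le> d" for i
    using data that unfolding corresponding_primary_q_data_def power_int_q_forms[OF q(1)] q_eig_def
    by simp
  then have "\<mu>s = 0 \<or> hs = 0" by (rule V.dual_q_Krawtchouk_geometric[OF d dual std])
  then have "\<mu>' \<noteq> 0 \<and> \<mu>' + h' = 0 \<and>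
    ((\<exists>A. near_bipartite_expansion scale d B A As \<and>
           primary_q_data scale d q A As \<delta> \<mu> h \<delta>s \<mu>s hs \<tau>) \<longleftrightarrow>
      \<tau> = 0 \<and> \<mu> * h = \<mu>' * h' \<and>
      (\<forall>k. 1 - int d \<le> k \<and> k \<le> int d - 1 \<longrightarrow> \<mu> \<noteq> h * q powi (2 * k))) \<and>
    (\<forall>A. near_bipartite_expansion scale d B A As \<longrightarrow>
          primary_q_data scale d q A As \<delta> \<mu> h \<delta>s \<mu>s hs \<tau> \<longrightarrow> dual_q_Krawtchouk scale d q A As)"
  proof
    assume hs: "hs = 0"
    show ?thesis
      unfolding hs by (intro conjI allI impI V.near_bipartite_expansion_hs_zero[OF d bip tI par data[unfolded hs]])
  next
    assume \<mu>s: "\<mu>s = 0"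
    \<comment> \<open>Relative to \<open>inverse q\<close> the last dual coefficient is
      \<open>\<mu>s = 0\<close>, so the case already treated applies with \<open>\<mu>\<close>,
      \<open>h\<close> and \<open>\<mu>'\<close>, \<open>h'\<close> exchanged.\<close>
    have data_inv: "corresponding_primary_q_data d (inverse q) \<theta>' \<theta>s vphi' phi' \<delta>' h' \<mu>' \<delta>s hs 0 \<tau>'"
      using data unfolding corresponding_primary_q_data_inverse \<mu>s .
    have tI_inv: "type_I scale d (inverse q) B As" using tI by (simp add: V.type_I_inverse)
    note inv = V.near_bipartite_expansion_hs_zero[OF d bip tI_inv par data_inv]
    have "h' \<noteq> 0" "h' + \<mu>' = 0" by (rule inv)+
    then have \<mu>': "\<mu>' \<noteq> 0 \<and> \<mu>' + h' = 0" by (auto simp: add.commute)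
    have sym: "h = \<mu> * inverse q powi (2 * k) \<longleftrightarrow> \<mu> = h * q powi (2 * k)" for k
      using q(1) by (auto simp: power_int_inverse field_simps)
    have iff: "(\<exists>A. near_bipartite_expansion scale d B A As \<and>
        primary_q_data scale d q A As \<delta> \<mu> h \<delta>s 0 hs \<tau>) \<longleftrightarrow>
      \<tau> = 0 \<and> \<mu> * h = \<mu>' * h' \<and>
      (\<forall>k. 1 - int d \<le> k \<and> k \<le> int d - 1 \<longrightarrow> \<mu> \<noteq> h * q powi (2 * k))"
      using inv(3)[of \<delta> h \<mu> \<tau>] unfolding V.primary_q_data_inverse sym
      by (simp only: mult.commute)
    have "dual_q_Krawtchouk scale d q A As"
      if "near_bipartite_expansion scale d B A As"
        "primary_q_data scale d q A As \<delta> \<mu> h \<delta>s 0 hs \<tau>" for A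
      using inv(4)[of A \<delta> h \<mu> \<tau>] that
      unfolding V.primary_q_data_inverse V.dual_q_Krawtchouk_inverse by blast
    then show ?thesis unfolding \<mu>s using \<mu>' iff by blast
  qed
  \<comment> \<open>The reinforcement concerns only \<open>q\<close> and \<open>d\<close>, so it
    passes from \<open>B\<close> to every expansion.\<close>
  then show ?thesis
    using primary_parameters_iff[OF q(1), of \<mu>' h' \<tau> \<mu> h d] reinf
    unfolding reinforced_dual_q_Krawtchouk_def by blast
qed

end
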